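(* Let $\kappa\ge2$, $n\ge1$ be integers and $0<\epsilon<1$. Let $\check q$ be the first subspace exclusion code vector: $\check q_i=0$ for $0\le i<2^{\kappa-1}$ and $\check q_i=2^{1-\kappa}$ for $2^{\kappa-1}\le i\le 2^\kappa-1$. Let $\mathcal{C}_{\rho}$ be the set of $q\in\mathbb{R}^{2^\kappa}$ with $q_0=0$, $q_i\ge0$ for all $i$, $\sum_i q_i=1$, and $\Big(\sum_{i=1}^{2^\kappa-1}\big(q_i-\tfrac{1}{2^\kappa-1}\big)^2\Big)^{1/2}=\sqrt{\frac{2^{\kappa-1}-1}{(2^\kappa-2^{\kappa-1})(2^\kappa-1)}}.$ Then $\check q\in\mathcal{C}_\rho$ and $\check q$ is a local minimizer of $q\mapsto l(n,\epsilon,q)$ on $\mathcal{C}_\rho$.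
   Context: $W=\mathbb{F}_2^\kappa$; $\nu(i)\in W$ is the binary expansion of $i\in\{0,\dots,2^\kappa-1\}$ (so $\{\nu(i):i<2^{\kappa-1}\}$ is a $(\kappa-1)$-dimensional subspace); vectors $q\in\mathbb{R}^{2^\kappa}$ are indexed $q_0,\dots,q_{2^\kappa-1}$. For a subspace $S\subseteq W$, $\zeta(S,q)=\sum_{i:\nu(i)\in S}q_i$; $\Xi(W,d)$ is the set of $d$-dimensional subspaces of $W$. For real $q$, the (continuous) expected equivocation loss is $l(n,\epsilon,q)=n(1-\epsilon)-\kappa+\sum_{\delta=1}^{\kappa}K_\delta\sum_{S\in\Xi(W,\kappa-\delta)}\epsilon^{n(1-\zeta(S,q))}$, with $K_\delta=\prod_{i=1}^{\delta-1}(1-2^i)$. The radius condition says that $(q_1,\dots,q_{2^\kappa-1})$ lies at the same Euclidean distance from the uniform vector $(\frac{1}{2^\kappa-1},\dots)$ as $(\check q_1,\dots,\check q_{2^\kappa-1})$ does. A local minimizer of $f$ on a set $\mathcal{C}$ is a point $q\in\mathcal{C}$ with $f(q)\le f(q')$ for all $q'\in\mathcal{C}$ in some neighborhood of $q$. *)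

theory Defs
  imports "HOL-Analysis.Analysis"
begin

(* Vectors of W = F_2^kappa are represented as functions nat => bool that vanish
   at coordinates >= kappa; pointwise xor is vector addition over F_2. *)
definition Wsp :: "nat \<Rightarrow> (nat \<Rightarrow> bool) set" where
  "Wsp k = {v. \<forall>j\<ge>k. \<not> v j}"

definition nu :: "nat \<Rightarrow> nat \<Rightarrow> (nat \<Rightarrow> bool)" where
  "nu k i = (\<lambda>j. j < k \<and> bit i j)"

definition f2sum :: "(nat \<Rightarrow> bool) set \<Rightarrow> (nat \<Rightarrow> bool)" where
  "f2sum T = (\<lambda>j. odd (card {v\<in>T. v j}))"

definition f2span :: "(nat \<Rightarrow> bool) set \<Rightarrow> (nat \<Rightarrow> bool) set" where
  "f2span B = {f2sum T | T. T \<subseteq> B}"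

definition f2indep :: "(nat \<Rightarrow> bool) set \<Rightarrow> bool" where
  "f2indep B \<longleftrightarrow> finite B \<and> (\<forall>T\<subseteq>B. f2sum T = (\<lambda>_. False) \<longrightarrow> T = {})"

definition Xi :: "nat \<Rightarrow> nat \<Rightarrow> (nat \<Rightarrow> bool) set set" where
  "Xi k d = {S. \<exists>B. B \<subseteq> Wsp k \<and> f2indep B \<and> card B = d \<and> S = f2span B}"

definition zeta :: "nat \<Rightarrow> (nat \<Rightarrow> bool) set \<Rightarrow> (nat \<Rightarrow> real) \<Rightarrow> real" where
  "zeta k S q = (\<Sum>i \<in> {i. i < 2^k \<and> nu k i \<in> S}. q i)"

definition Kc :: "nat \<Rightarrow> real" where
  "Kc d = (\<Prod>i=1..<d. 1 - 2^i)"

definition loss :: "nat \<Rightarrow> nat \<Rightarrow> real \<Rightarrow> (nat \<Rightarrow> real) \<Rightarrow> real" where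
  "loss k n eps q = real n * (1 - eps) - real k
     + (\<Sum>d=1..k. Kc d * (\<Sum>S\<in>Xi k (k - d). eps powr (real n * (1 - zeta k S q))))"

definition qcheck :: "nat \<Rightarrow> nat \<Rightarrow> real" where
  "qcheck k i = (if i < 2^(k-1) then 0 else if i < 2^k then 2 powr (1 - real k) else 0)"

(* the constraint set C_rho; vectors q in R^(2^kappa) are q :: nat => real, only
   the coordinates 0..2^kappa-1 matter *)
definition Crho :: "nat \<Rightarrow> (nat \<Rightarrow> real) set" where
  "Crho k = {q. q 0 = 0 \<and> (\<forall>i<2^k. q i \<ge> 0) \<and> (\<Sum>i<2^k. q i) = 1 \<and>
      sqrt (\<Sum>i=1..<2^k. (q i - 1 / (2^k - 1))^2)
        = sqrt ((2^(k-1) - 1) / ((2^k - 2^(k-1)) * (2^k - 1)))}"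

definition vdist :: "nat \<Rightarrow> (nat \<Rightarrow> real) \<Rightarrow> (nat \<Rightarrow> real) \<Rightarrow> real" where
  "vdist k q q' = sqrt (\<Sum>i<2^k. (q i - q' i)^2)"

definition local_min_on :: "nat \<Rightarrow> ((nat \<Rightarrow> real) \<Rightarrow> real) \<Rightarrow> (nat \<Rightarrow> real) set \<Rightarrow> (nat \<Rightarrow> real) \<Rightarrow> bool" where
  "local_min_on k f C q \<longleftrightarrow> q \<in> C \<and>
     (\<exists>r>0. \<forall>q'\<in>C. vdist k q q' < r \<longrightarrow> f q \<le> f q')"

end

theory Submission
  imports Defs
begin

text \<open>Put \<open>\<lambda> = -n ln \<epsilon>\<close>, \<open>M = 2^(\<kappa>-1)\<close>, let \<open>H\<close> be the excluded hyperplane and \<open>A\<close> its complement.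
  On the constraint set the loss is, up to an affine change, the sum over all subspaces \<open>S\<close> of
  \<open>K_S exp (\<lambda> \<zeta>(S, q))\<close>. For a displacement \<open>z\<close> from \<open>qcheck\<close> inside the constraint set, the
  radius condition gives \<open>\<Sum>_H z = (M/2) |z|^2\<close>, and \<open>\<Sum>_A z = - \<Sum>_H z\<close>. Transvections
  preserving \<open>H\<close> act transitively on \<open>A\<close>, on \<open>H - {0}\<close>, and on pairs of distinct points of \<open>A\<close>,
  so that the gradient is constant on \<open>A\<close> and on \<open>H - {0}\<close> and the Hessian on \<open>A\<close> has constant
  diagonal and constant off-diagonal part. The loss therefore increases by a positive multiple of
  \<open>(\<lambda> U' + 1 - U) |z|^2\<close> plus a cubic error, where \<open>U(\<lambda>)\<close> is the sum of
  \<open>K_S exp (\<lambda> |S \<inter> A| / M)\<close> over the subspaces avoiding a fixed \<open>h \<in> H - {0}\<close>.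
  By the Moebius-type identity that \<open>K_S\<close> sums to 1 over the subspaces containing a given subspace
  \<open>V\<close> and avoiding a given \<open>h \<notin> V\<close>, the \<open>n\<close>-th Taylor coefficient of \<open>U\<close> is, up to \<open>1 / n!\<close>,
  the probability that \<open>n\<close> random points of \<open>A\<close> do not span \<open>h\<close>. Hence \<open>U(0) = 1\<close>, the
  coefficients of \<open>\<lambda> U' + 1 - U\<close> are nonnegative, and that of \<open>\<lambda>^2\<close> is positive.\<close>

section \<open>Subspaces of the binary vector space\<close>

definition vadd :: "(nat \<Rightarrow> bool) \<Rightarrow> (nat \<Rightarrow> bool) \<Rightarrow> nat \<Rightarrow> bool" where
  "vadd u v = (\<lambda>j. u j \<noteq> v j)"

abbreviation vzero :: "nat \<Rightarrow> bool" where
  "vzero \<equiv> (\<lambda>_. False)"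

lemma vadd_commute: "vadd u v = vadd v u"
  by (auto simp: vadd_def)

lemma vadd_assoc: "vadd (vadd u v) w = vadd u (vadd v w)"
  by (auto simp: vadd_def)

lemma vadd_left_commute: "vadd u (vadd v w) = vadd v (vadd u w)"
  by (auto simp: vadd_def)

lemmas vadd_ac = vadd_assoc vadd_commute vadd_left_commute

lemma vadd_simps [simp]:
  "vadd v v = vzero" "vadd vzero v = v" "vadd v vzero = v" "vadd u (vadd u v) = v"
  by (auto simp: vadd_def)

lemma vadd_left_cancel [simp]: "vadd u v = vadd u w \<longleftrightarrow> v = w"
  by (auto simp: vadd_def fun_eq_iff)

lemma vadd_eq_vzero_iff [simp]: "vadd u v = vzero \<longleftrightarrow> u = v"
  by (auto simp: vadd_def fun_eq_iff)

lemma inj_vadd: "inj_on (vadd u) S"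
  by (simp add: inj_on_def)

text \<open>Closure under addition suffices because 0 and 1 are the only scalars.
  \<open>Xi_eq\<close> links this notion to spans of independent sets.\<close>

definition subsp :: "nat \<Rightarrow> (nat \<Rightarrow> bool) set set" where
  "subsp k = {S. S \<subseteq> Wsp k \<and> vzero \<in> S \<and> (\<forall>u\<in>S. \<forall>v\<in>S. vadd u v \<in> S)}"

lemma subspD:
  assumes "S \<in> subsp k"
  shows "S \<subseteq> Wsp k" "vzero \<in> S" "\<And>u v. u \<in> S \<Longrightarrow> v \<in> S \<Longrightarrow> vadd u v \<in> S"
  using assms by (auto simp: subsp_def)

lemma subsp_vadd_iff:
  assumes "S \<in> subsp k" "u \<in> S"
  shows "vadd u v \<in> S \<longleftrightarrow> v \<in> S" "vadd v u \<in> S \<longleftrightarrow> v \<in> S"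
proof -
  show *: "vadd u v \<in> S \<longleftrightarrow> v \<in> S"
    using subspD(3)[OF assms] subspD(3)[OF assms, of "vadd u v"] by auto
  show "vadd v u \<in> S \<longleftrightarrow> v \<in> S" using * by (simp add: vadd_commute)
qed

lemma Wsp_subsp: "Wsp k \<in> subsp k"
  by (auto simp: subsp_def Wsp_def vadd_def)

lemma line_subsp: "b \<in> Wsp k \<Longrightarrow> {vzero, b} \<in> subsp k"
  by (auto simp: subsp_def Wsp_def)

lemma Int_subsp: "S \<in> subsp k \<Longrightarrow> T \<in> subsp k \<Longrightarrow> S \<inter> T \<in> subsp k"
  by (auto simp: subsp_def)

text \<open>Two elements of the coset of \<open>w\<close> add up to an element of \<open>S\<close>,
  since \<open>w\<close> cancels itself in characteristic two.\<close>

lemma join_subsp: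
  assumes "S \<in> subsp k" "w \<in> Wsp k"
  shows "S \<union> vadd w ` S \<in> subsp k"
proof -
  have W: "vadd w u \<in> Wsp k" if "u \<in> S" for u
    using that assms subspD[OF assms(1)] subspD(3)[OF Wsp_subsp] by blast
  have "vadd u v \<in> S \<union> vadd w ` S" if u: "u \<in> S \<union> vadd w ` S" and v: "v \<in> S \<union> vadd w ` S" for u v
  proof -
    have 1: "vadd a b \<in> S" if "a \<in> S" "b \<in> S" for a b
      using that subspD[OF assms(1)] by blast
    have 2: "vadd a (vadd w b) \<in> vadd w ` S" if "a \<in> S" "b \<in> S" for a b
      using 1[OF that] by (metis image_eqI vadd_left_commute)
    have 3: "vadd (vadd w a) (vadd w b) \<in> S" if "a \<in> S" "b \<in> S" for a b
      using 1[OF that] by (metis vadd_assoc vadd_commute vadd_simps(4))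
    have 4: "vadd (vadd w b) a \<in> vadd w ` S" if "a \<in> S" "b \<in> S" for a b
      using 2[OF that] by (simp only: vadd_commute)
    from u v 1 2 3 4 show ?thesis by (elim UnE imageE) (simp_all only: Un_iff simp_thms)
  qed
  then show ?thesis using W subspD[OF assms(1)] by (auto simp: subsp_def)
qed

lemma nu_bij: "bij_betw (nu k) {..<2^k} (Wsp k)"
proof (rule bij_betw_imageI)
  show "inj_on (nu k) {..<2^k}"
  proof (rule inj_onI)
    fix i j :: nat assume i: "i \<in> {..<2^k}" and j: "j \<in> {..<2^k}" and e: "nu k i = nu k j"
    have "bit i l = bit j l" for l
    proof (cases "l < k")
      case True
      then show ?thesis using fun_cong[OF e, of l] by (simp add: nu_def)
    next
      case False
      have "take_bit k i = i" "take_bit k j = j"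
        using i j by (simp_all add: take_bit_nat_eq_self)
      then show ?thesis using False by (metis bit_take_bit_iff)
    qed
    then show "i = j" by (simp add: bit_eq_iff)
  qed
  show "nu k ` {..<2^k} = Wsp k"
  proof (intro equalityI subsetI)
    fix v assume v: "v \<in> Wsp k"
    \<comment> \<open>The preimage is the integer whose binary digits are the coordinates of
      \<open>v\<close>.\<close>
    define i :: nat where i: "i = horner_sum of_bool 2 (map v [0..<k])"
    have "i < 2^k"
      using horner_sum_bound[of "map v [0..<k]", where ?'a = nat] unfolding i by simp
    moreover have "nu k i = v"
    proof
      fix j
      show "nu k i j = v j"
        using v by (cases "j < k") (auto simp: nu_def i bit_horner_sum_bit_iff Wsp_def)
    qed
    ultimately show "v \<in> nu k ` {..<2^k}" by auto
  qed (auto simp: nu_def Wsp_def)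
qed

lemma finite_Wsp [simp]: "finite (Wsp k)"
  using bij_betw_finite[OF nu_bij] by simp

lemma card_Wsp: "card (Wsp k) = 2^k"
  using bij_betw_same_card[OF nu_bij] by simp

lemma finite_subsp [simp]: "finite (subsp k)"
  by (rule finite_subset[of _ "Pow (Wsp k)"]) (auto simp: subsp_def)

lemma subsp_finite: "S \<in> subsp k \<Longrightarrow> finite S"
  using finite_subset[OF subspD(1)] by simp

section \<open>Subset sums and bases over the field with two elements\<close>

lemma f2sum_empty [simp]: "f2sum {} = vzero"
  by (simp add: f2sum_def)

lemma f2sum_insert:
  assumes "finite T" "v \<notin> T"
  shows "f2sum (insert v T) = vadd v (f2sum T)"
proof
  fix j
  have "{u \<in> insert v T. u j} = (if v j then insert v {u \<in> T. u j} else {u \<in> T. u j})" by auto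
  then show "f2sum (insert v T) j = vadd v (f2sum T) j"
    using assms by (auto simp: f2sum_def vadd_def)
qed

lemma f2sum_mem:
  assumes "S \<in> subsp k" "finite T" "T \<subseteq> S"
  shows "f2sum T \<in> S"
  using assms(2,3)
proof (induction T rule: finite_induct)
  case empty
  then show ?case using subspD(2)[OF assms(1)] by simp
next
  case (insert v T)
  then show ?case using subspD(3)[OF assms(1), of v "f2sum T"] by (simp add: f2sum_insert)
qed

text \<open>Common elements cancel in characteristic two. This yields both the closure of spans and
  the injectivity of subset sums on independent sets.\<close>

lemma f2sum_sym_diff:
  assumes "finite T" "finite U"
  shows "f2sum ((T - U) \<union> (U - T)) = vadd (f2sum T) (f2sum U)"
proof
  fix j
  let ?A = "{v\<in>T. v j}" and ?B = "{v\<in>U. v j}"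
  have fin: "finite ?A" "finite ?B" using assms by auto
  have "{v \<in> (T - U) \<union> (U - T). v j} = (?A - ?B) \<union> (?B - ?A)" by auto
  then have "card {v \<in> (T - U) \<union> (U - T). v j} = card (?A - ?B) + card (?B - ?A)"
    using fin by (subst card_Un_disjoint[symmetric]) auto
  moreover have "card ?A = card (?A - ?B) + card (?A \<inter> ?B)" "card ?B = card (?B - ?A) + card (?A \<inter> ?B)"
    using card_Diff_subset_Int[of ?A ?B] card_Diff_subset_Int[of ?B ?A] fin
      card_mono[of ?A "?A \<inter> ?B"] card_mono[of ?B "?A \<inter> ?B"] by (auto simp: Int_commute)
  ultimately show "f2sum ((T - U) \<union> (U - T)) j = vadd (f2sum T) (f2sum U) j"
    by (auto simp: f2sum_def vadd_def)
qed

lemma card_f2span: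
  assumes "f2indep B"
  shows "card (f2span B) = 2 ^ card B"
proof -
  have fin: "finite B" using assms by (simp add: f2indep_def)
  have "inj_on f2sum (Pow B)"
  proof (rule inj_onI)
    fix T U assume TU: "T \<in> Pow B" "U \<in> Pow B" "f2sum T = f2sum U"
    then have "finite T" "finite U" using fin finite_subset by auto
    then have "f2sum ((T - U) \<union> (U - T)) = vzero" using TU(3) by (simp add: f2sum_sym_diff)
    moreover have "(T - U) \<union> (U - T) \<subseteq> B" using TU by auto
    ultimately have "(T - U) \<union> (U - T) = {}" using assms unfolding f2indep_def by blast
    then show "T = U" by blast
  qed
  moreover have "f2span B = f2sum ` Pow B" by (auto simp: f2span_def)
  ultimately show ?thesis using fin by (simp add: card_image card_Pow)
qed

lemma f2span_subsp:
  assumes "B \<subseteq> Wsp k"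
  shows "f2span B \<in> subsp k"
proof -
  have fin: "finite T" if "T \<subseteq> B" for T
    by (rule finite_subset[OF that finite_subset[OF assms finite_Wsp]])
  have "f2sum T \<in> Wsp k" if "T \<subseteq> B" for T
    using f2sum_mem[OF Wsp_subsp fin[OF that]] that assms by blast
  moreover have "vzero \<in> f2span B" unfolding f2span_def
    by (intro CollectI exI[of _ "{}"]) simp
  moreover have "vadd (f2sum T) (f2sum U) \<in> f2span B" if "T \<subseteq> B" "U \<subseteq> B" for T U
    unfolding f2span_def f2sum_sym_diff[OF fin[OF that(1)] fin[OF that(2)], symmetric]
    by (intro CollectI exI[of _ "(T - U) \<union> (U - T)"]) (use that in auto)
  ultimately show ?thesis by (auto simp: subsp_def f2span_def)
qed

text \<open>A maximal independent subset spans, because any vector outside its span could be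
  adjoined.\<close>

lemma subsp_has_basis:
  assumes S: "S \<in> subsp k"
  obtains B where "B \<subseteq> S" "f2indep B" "S = f2span B"
proof -
  let ?I = "{B. B \<subseteq> S \<and> f2indep B}"
  have finS: "finite S" using S by (rule subsp_finite)
  have "finite ?I" by (rule finite_subset[of _ "Pow S"]) (use finS in auto)
  moreover have "{} \<in> ?I" by (auto simp: f2indep_def)
  ultimately obtain B where B: "B \<in> ?I" and max: "\<forall>C\<in>?I. B \<subseteq> C \<longrightarrow> B = C"
    using finite_has_maximal[of ?I] by blast
  have BS: "B \<subseteq> S" and Bi: "f2indep B" using B by auto
  have finB: "finite B" using Bi by (simp add: f2indep_def)
  have "f2span B \<subseteq> S"
    using f2sum_mem[OF S] BS finite_subset[OF _ finB] by (auto simp: f2span_def)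
  moreover have "v \<in> f2span B" if v: "v \<in> S" for v
  proof (rule ccontr)
    assume nv: "v \<notin> f2span B"
    have vB: "v \<notin> B"
    proof
      assume "v \<in> B"
      then have "{v} \<subseteq> B" by simp
      moreover have "f2sum {v} = v" using f2sum_insert[of "{}" v] by simp
      ultimately show False using nv unfolding f2span_def by (metis (mono_tags, lifting) mem_Collect_eq)
    qed
    \<comment> \<open>A vanishing sum that involves \<open>v\<close> would express \<open>v\<close>
      through \<open>B\<close>.\<close>
    have "T = {}" if T: "T \<subseteq> insert v B" "f2sum T = vzero" for T
    proof (cases "v \<in> T")
      case True
      let ?U = "T - {v}"
      have U: "?U \<subseteq> B" "finite ?U" using T finB finite_subset by auto
      have "f2sum T = vadd v (f2sum ?U)"
        using f2sum_insert[OF U(2), of v] True by (simp add: insert_absorb)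
      then have "f2sum ?U = v" using T(2) by (metis vadd_eq_vzero_iff)
      then have "v \<in> f2span B" using U(1) unfolding f2span_def by (metis (mono_tags, lifting) mem_Collect_eq)
      then show ?thesis using nv by contradiction
    next
      case False
      then show ?thesis using T Bi unfolding f2indep_def by blast
    qed
    then have "insert v B \<in> ?I" using BS v finB by (auto simp: f2indep_def)
    then show False using max vB by (metis insertI1 subset_insertI)
  qed
  ultimately show thesis using that[OF BS Bi] by blast
qed

text \<open>Dimension becomes cardinality, so later dimension arguments reduce to counting
  elements.\<close>

lemma Xi_eq: "Xi k d = {S \<in> subsp k. card S = 2^d}"
proof (intro equalityI subsetI)
  fix S assume "S \<in> Xi k d"
  then show "S \<in> {S \<in> subsp k. card S = 2^d}"
    by (auto simp: Xi_def card_f2span f2span_subsp)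
next
  fix S assume S: "S \<in> {S \<in> subsp k. card S = 2^d}"
  then obtain B where B: "B \<subseteq> S" "f2indep B" "S = f2span B" using subsp_has_basis by blast
  then have "card B = d" using S card_f2span by fastforce
  then show "S \<in> Xi k d" unfolding Xi_def using B S subspD(1) by blast
qed

section \<open>Codimension and the weights of subspaces\<close>

definition cod :: "nat \<Rightarrow> (nat \<Rightarrow> bool) set \<Rightarrow> nat" where
  "cod k S = (THE d. 2^d * card S = 2^k)"

text \<open>Codimension is read off from the cardinality alone, hence any bijection between
  subspaces preserves it.\<close>

lemma cod_eqI: "2^d * card S = 2^k \<Longrightarrow> cod k S = d"
proof -
  assume d: "2^d * card S = 2^k"
  then have "card S \<noteq> 0" by (metis mult_0_right power_not_zero zero_neq_numeral)
  have "e = d" if "2^e * card S = 2^k" for e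
  proof -
    have "2^e * card S = 2^d * card S" using that d by simp
    then show ?thesis using \<open>card S \<noteq> 0\<close> by simp
  qed
  with d show ?thesis unfolding cod_def by (rule the_equality)
qed

lemma cod_card:
  assumes S: "S \<in> subsp k"
  shows "2^(cod k S) * card S = 2^k" and "cod k S \<le> k" and "card S = 2^(k - cod k S)"
proof -
  obtain B where B: "B \<subseteq> S" "f2indep B" "S = f2span B" using subsp_has_basis[OF S] by blast
  have c: "card S = 2^card B" using B card_f2span by simp
  have "card S \<le> 2^k" using card_mono[OF finite_Wsp subspD(1)[OF S]] by (simp add: card_Wsp)
  then have le: "card B \<le> k" unfolding c by simp
  then have "2^(k - card B) * card S = 2^k" by (simp add: c flip: power_add)
  then have d: "cod k S = k - card B" by (rule cod_eqI)
  then show "2^(cod k S) * card S = 2^k" "cod k S \<le> k" "card S = 2^(k - cod k S)"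
    using le c by (simp_all flip: power_add)
qed

lemma cod_eq_0_iff: "S \<in> subsp k \<Longrightarrow> cod k S = 0 \<longleftrightarrow> S = Wsp k"
proof
  assume "S \<in> subsp k" "cod k S = 0"
  then show "S = Wsp k"
    using cod_card(3)[of S k] card_subset_eq[OF finite_Wsp subspD(1)] by (simp add: card_Wsp)
next
  assume "S = Wsp k"
  then show "cod k S = 0" by (intro cod_eqI) (simp add: card_Wsp)
qed

text \<open>The whole space gets weight 1, an empty product. The sum in \<open>loss\<close> starts
  at codimension 1 and omits it.\<close>

definition wt :: "nat \<Rightarrow> (nat \<Rightarrow> bool) set \<Rightarrow> real" where
  "wt k S = Kc (cod k S)"

lemma sum_Xi_eq:
  fixes g :: "(nat \<Rightarrow> bool) set \<Rightarrow> real"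
  shows "(\<Sum>d=1..k. Kc d * (\<Sum>S\<in>Xi k (k - d). g S)) = (\<Sum>S\<in>subsp k - {Wsp k}. wt k S * g S)"
proof -
  have Xi: "Xi k (k - d) = {S \<in> subsp k - {Wsp k}. cod k S = d}" if d: "d \<in> {1..k}" for d
  proof (intro equalityI subsetI)
    fix S assume "S \<in> Xi k (k - d)"
    then have S: "S \<in> subsp k" "card S = 2^(k-d)" by (auto simp: Xi_eq)
    then have "cod k S = d" using d by (intro cod_eqI) (simp flip: power_add)
    then show "S \<in> {S \<in> subsp k - {Wsp k}. cod k S = d}" using S d cod_eq_0_iff by fastforce
  next
    fix S assume "S \<in> {S \<in> subsp k - {Wsp k}. cod k S = d}"
    then have "S \<in> subsp k" "cod k S = d" by auto
    then show "S \<in> Xi k (k - d)" using cod_card(3)[of S k] by (simp add: Xi_eq)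
  qed
  have "(\<Sum>d=1..k. Kc d * (\<Sum>S\<in>Xi k (k - d). g S))
      = (\<Sum>d=1..k. \<Sum>S\<in>{S \<in> subsp k - {Wsp k}. cod k S = d}. wt k S * g S)"
    by (intro sum.cong refl) (simp add: Xi sum_distrib_left wt_def)
  also have "\<dots> = (\<Sum>S\<in>subsp k - {Wsp k}. wt k S * g S)"
  proof (rule sum.group)
    show "cod k ` (subsp k - {Wsp k}) \<subseteq> {1..k}"
      using cod_card(2) cod_eq_0_iff by (fastforce simp: Suc_le_eq)
  qed auto
  finally show ?thesis .
qed

section \<open>Sums over subspaces avoiding a vector\<close>

text \<open>\<open>Kc 0\<close> and \<open>Kc 1\<close> are empty products, which gives 1 at
  \<open>d = 0\<close>. For larger \<open>d\<close> the new factor \<open>1 - 2^d\<close> cancels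
  the second summand.\<close>

lemma Kc_recurrence: "Kc (Suc d) + (2^d - 1) * Kc d = of_bool (d = 0)"
proof (cases d)
  case (Suc e)
  then have "Kc (Suc d) = Kc d * (1 - 2^d)"
    unfolding Kc_def by (subst prod.atLeastLessThan_Suc) auto
  then show ?thesis using Suc by (simp add: algebra_simps)
qed (simp add: Kc_def)

text \<open>Group the subspaces \<open>S\<close> by their trace \<open>R = S \<inter> P\<close>. If \<open>R\<close> has codimension \<open>d\<close> in
  \<open>P\<close>, the fibre consists of \<open>R\<close> itself, of codimension \<open>d + 1\<close>, and of \<open>2^d - 1\<close>
  subspaces \<open>R \<union> (w + R)\<close> of codimension \<open>d\<close>; by \<open>Kc_recurrence\<close> everything but \<open>R = P\<close> cancels.\<close>

lemma sum_avoiding_Int_hyperplane: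
  fixes \<phi> :: "(nat \<Rightarrow> bool) set \<Rightarrow> real"
  assumes P: "P \<in> subsp k" and h: "h \<in> Wsp k" "h \<notin> P"
    and cover: "Wsp k = P \<union> vadd h ` P"
  shows "(\<Sum>S | S \<in> subsp k \<and> h \<notin> S. wt k S * \<phi> (S \<inter> P)) = \<phi> P"
proof -
  let ?X = "{S. S \<in> subsp k \<and> h \<notin> S}" and ?Y = "{S. S \<in> subsp k \<and> S \<subseteq> P}"
  note Pfin = subsp_finite[OF P]
  have disj: "P \<inter> vadd h ` P = {}"
    using h subsp_vadd_iff(2)[OF P] by auto
  have cardW: "2^k = 2 * card P"
    using Pfin disj card_Un_disjoint[of P "vadd h ` P"] cover card_Wsp[of k]
    by (simp add: card_image inj_vadd)
  have offP: "Wsp k - P = vadd h ` P" using cover disj by auto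
  have fibre: "(\<Sum>S | S \<in> ?X \<and> S \<inter> P = R. wt k S * \<phi> (S \<inter> P)) = of_bool (R = P) * \<phi> R"
    if R: "R \<in> ?Y" for R
  proof -
    have Rs: "R \<in> subsp k" and RP: "R \<subseteq> P" using R by auto
    have Rfin: "finite R" and R0: "card R > 0"
      using subsp_finite[OF Rs] subspD(2)[OF Rs] by (auto simp: card_gt_0_iff)
    \<comment> \<open>The fibre over \<open>R\<close> without \<open>R\<close> itself.\<close>
    define L where "L = {S. S \<in> subsp k \<and> h \<notin> S \<and> S \<inter> P = R \<and> S \<noteq> R}"
    have Lfin: "finite L" by (simp add: L_def)
    \<comment> \<open>Outside \<open>P\<close> everything lies in \<open>h + P\<close>, so two
      elements of \<open>S - R\<close> differ by an element of
      \<open>S \<inter> P = R\<close>.\<close>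
    have coset: "S - R = vadd w ` R" if S: "S \<in> L" and w: "w \<in> S - R" for S w
    proof (intro equalityI subsetI)
      have Ss: "S \<in> subsp k" and SP: "S \<inter> P = R" using S by (auto simp: L_def)
      fix u assume u: "u \<in> S - R"
      have "u \<in> Wsp k - P" "w \<in> Wsp k - P" using u w SP subspD(1)[OF Ss] by auto
      then obtain p q where "u = vadd h p" "w = vadd h q" "p \<in> P" "q \<in> P" unfolding offP by auto
      then have "vadd w u \<in> P" using subspD(3)[OF P, of q p] by (simp add: vadd_ac)
      moreover have "vadd w u \<in> S" using u w subspD(3)[OF Ss] by auto
      ultimately have "vadd w u \<in> R" using SP by auto
      then show "u \<in> vadd w ` R" by (intro image_eqI[of _ _ "vadd w u"]) auto
    next
      have Ss: "S \<in> subsp k" and SP: "S \<inter> P = R" using S by (auto simp: L_def)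
      fix u assume "u \<in> vadd w ` R"
      then obtain r where r: "r \<in> R" "u = vadd w r" by auto
      then have "u \<in> S" using w SP subspD(3)[OF Ss, of w r] by auto
      then show "u \<in> S - R" using r w subsp_vadd_iff(2)[OF Rs, of r w] by auto
    qed
    have RL: "R \<subseteq> S" if "S \<in> L" for S using that by (auto simp: L_def)
    have ne: "\<exists>w. w \<in> S - R" if "S \<in> L" for S using that RL[OF that] by (auto simp: L_def)
    have cd: "card (S - R) = card R" if "S \<in> L" for S
      using ne[OF that] coset[OF that] by (auto simp: card_image inj_vadd)
    \<comment> \<open>These cosets fill \<open>h + P\<close> except for \<open>h + R\<close>: a
      subspace containing \<open>R\<close> and some \<open>h + r\<close> would contain
      \<open>h\<close>.\<close>
    have un: "(\<Union>S\<in>L. S - R) = vadd h ` P - vadd h ` R"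
    proof (intro equalityI subsetI)
      fix u assume "u \<in> (\<Union>S\<in>L. S - R)"
      then obtain S where S: "S \<in> L" "u \<in> S - R" by auto
      then have Ss: "S \<in> subsp k" and SP: "S \<inter> P = R" and hS: "h \<notin> S" by (auto simp: L_def)
      have "u \<in> vadd h ` P" unfolding offP[symmetric] using S SP subspD(1)[OF Ss] by auto
      moreover have "u \<noteq> vadd h r" if "r \<in> R" for r
        using that hS S(2) SP subsp_vadd_iff(2)[OF Ss, of r h] by auto
      ultimately show "u \<in> vadd h ` P - vadd h ` R" by auto
    next
      fix w assume w: "w \<in> vadd h ` P - vadd h ` R"
      then have wP: "w \<in> Wsp k" "w \<notin> P" using offP by auto
      let ?S = "R \<union> vadd w ` R"
      have wr: "vadd w r \<notin> P" if "r \<in> R" for r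
        using wP(2) that RP subsp_vadd_iff(2)[OF P, of r w] by auto
      have "h \<noteq> vadd w r" if "r \<in> R" for r
      proof
        assume "h = vadd w r"
        then have "w = vadd h r" by (simp add: vadd_ac)
        then show False using w that by auto
      qed
      then have "h \<notin> ?S" using h(2) RP by auto
      moreover have "?S \<inter> P = R" using RP wr by auto
      moreover have "w \<in> ?S" using subspD(2)[OF Rs] by (auto intro!: image_eqI[of _ _ vzero])
      ultimately have "?S \<in> L" "w \<in> ?S - R"
        using join_subsp[OF Rs wP(1)] wP(2) RP by (auto simp: L_def)
      then show "w \<in> (\<Union>S\<in>L. S - R)" by blast
    qed
    have dj: "(S - R) \<inter> (T - R) = {}" if "S \<in> L" "T \<in> L" "S \<noteq> T" for S T
    proof (rule ccontr)
      assume "(S - R) \<inter> (T - R) \<noteq> {}"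
      then obtain u where "u \<in> S - R" "u \<in> T - R" by auto
      then have "S - R = T - R" using coset that by metis
      then show False using RL that by blast
    qed
    have "card (\<Union>S\<in>L. S - R) = (\<Sum>S\<in>L. card (S - R))"
      by (rule card_UN_disjoint) (use Lfin dj in \<open>auto simp: L_def subsp_finite\<close>)
    also have "\<dots> = card L * card R" using cd by simp
    finally have cL: "card L * card R = card P - card R"
      unfolding un using RP Rfin
      by (subst (asm) card_Diff_subset) (auto simp: card_image inj_vadd)
    \<comment> \<open>\<open>c\<close> is the codimension of \<open>R\<close> in the whole space. It
      exceeds the codimension \<open>d\<close> in \<open>P\<close> by one, because \<open>P\<close>
      has index two.\<close>
    define c where "c = cod k R"
    have c: "2^c * card R = 2^k" unfolding c_def by (rule cod_card(1)[OF Rs])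
    have "card R \<le> card P" using card_mono[OF Pfin RP] .
    then have "c \<noteq> 0" using c cardW R0 by (cases c) auto
    then obtain d where d: "c = Suc d" by (cases c) auto
    have cP: "2^d * card R = card P" using c cardW d by simp
    have "(card L + 1) * card R = 2^d * card R"
      using cL cP \<open>card R \<le> card P\<close> by (simp add: algebra_simps)
    then have "card L + 1 = 2^d" using R0 by (metis mult_right_cancel less_not_refl)
    then have cLr: "real (card L) = 2^d - 1"
      by (metis add_diff_cancel_right' of_nat_1 of_nat_add of_nat_numeral of_nat_power)
    \<comment> \<open>\<open>S\<close> consists of \<open>R\<close> and one further coset, so it is
      twice as large as \<open>R\<close> and its codimension drops to \<open>d\<close>.\<close>
    have wL: "wt k S = Kc d" if "S \<in> L" for S
    proof -
      have fS: "finite S" using that by (auto simp: L_def subsp_finite)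
      have "card S = card (S - R) + card R"
        using RL[OF that] fS Rfin by (simp add: card_Diff_subset card_mono)
      then have "2^d * card S = 2^k" using cd[OF that] c d by (simp add: algebra_simps)
      then have "cod k S = d" by (rule cod_eqI)
      then show ?thesis by (simp add: wt_def)
    qed
    have RiffP: "R = P \<longleftrightarrow> d = 0"
    proof
      assume "R = P" then show "d = 0" using cP R0 by simp
    next
      assume "d = 0" then show "R = P" using cP card_subset_eq[OF Pfin RP] by simp
    qed
    have "{S. S \<in> ?X \<and> S \<inter> P = R} = insert R L"
      using Rs RP h(2) by (auto simp: L_def)
    moreover have "R \<notin> L" by (simp add: L_def)
    ultimately have "(\<Sum>S | S \<in> ?X \<and> S \<inter> P = R. wt k S * \<phi> (S \<inter> P))
        = wt k R * \<phi> (R \<inter> P) + (\<Sum>S\<in>L. wt k S * \<phi> (S \<inter> P))"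
      using Lfin by simp
    also have "(\<Sum>S\<in>L. wt k S * \<phi> (S \<inter> P)) = (\<Sum>S\<in>L. Kc d * \<phi> R)"
      by (rule sum.cong[OF refl], subst wL) (auto simp: L_def)
    also have "wt k R * \<phi> (R \<inter> P) + \<dots> = (Kc (Suc d) + (2^d - 1) * Kc d) * \<phi> R"
      using RP c_def d by (simp add: wt_def Int_absorb2 cLr algebra_simps)
    finally show ?thesis by (simp add: Kc_recurrence RiffP)
  qed
  have "(\<Sum>S\<in>?X. wt k S * \<phi> (S \<inter> P))
      = (\<Sum>R\<in>?Y. \<Sum>S | S \<in> ?X \<and> S \<inter> P = R. wt k S * \<phi> (S \<inter> P))"
    by (rule sum.group[symmetric]) (use P in \<open>auto intro: Int_subsp\<close>)
  also have "\<dots> = (\<Sum>R\<in>?Y. of_bool (R = P) * \<phi> R)"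
    using fibre by (intro sum.cong refl) blast
  also have "\<dots> = (\<Sum>R\<in>{P}. \<phi> R)"
    by (rule sum.mono_neutral_cong_right) (use P in auto)
  finally show ?thesis by simp
qed

text \<open>Take \<open>P\<close> maximal among the subspaces that contain \<open>V\<close> and
  avoid \<open>h\<close>. Adjoining any \<open>w\<close> outside \<open>P\<close> must capture
  \<open>h\<close>, which puts \<open>w\<close> in \<open>h + P\<close>.\<close>

lemma separating_hyperplane:
  assumes V: "V \<in> subsp k" and h: "h \<in> Wsp k" "h \<notin> V"
  obtains P where "P \<in> subsp k" "V \<subseteq> P" "h \<notin> P" "Wsp k = P \<union> vadd h ` P"
proof -
  let ?I = "{P. P \<in> subsp k \<and> V \<subseteq> P \<and> h \<notin> P}"
  have "finite ?I" "?I \<noteq> {}" using V h by auto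
  from finite_has_maximal[OF this] obtain P where P: "P \<in> ?I"
    and max: "\<forall>Q\<in>?I. P \<subseteq> Q \<longrightarrow> P = Q" by (elim bexE)
  then have Ps: "P \<in> subsp k" and VP: "V \<subseteq> P" and hP: "h \<notin> P" by auto
  have "w \<in> P \<union> vadd h ` P" if w: "w \<in> Wsp k" for w
  proof (cases "w \<in> P")
    case False
    let ?Q = "P \<union> vadd w ` P"
    have "w \<in> ?Q" using subspD(2)[OF Ps] by (auto intro!: image_eqI[of _ _ vzero])
    then have "?Q \<notin> ?I" using max False by (metis Un_upper1)
    then have "h \<in> ?Q" using join_subsp[OF Ps w] VP by auto
    then obtain p where "p \<in> P" "h = vadd w p" using hP by auto
    then have "w = vadd h p" by (simp add: vadd_ac)
    then show ?thesis using \<open>p \<in> P\<close> by auto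
  qed simp
  moreover have "P \<union> vadd h ` P \<subseteq> Wsp k" using subspD(1)[OF join_subsp[OF Ps h(1)]] .
  ultimately show thesis using that[OF Ps VP hP] by blast
qed

text \<open>If \<open>V\<close> exists, a hyperplane \<open>P\<close> above it contains
  \<open>T\<close>, so \<open>T \<subseteq> S\<close> depends only on the trace of \<open>S\<close>
  on \<open>P\<close> and the previous cancellation applies. Otherwise every summand is
  zero.\<close>

lemma sum_avoiding_superset:
  assumes h: "h \<in> Wsp k"
  shows "(\<Sum>S | S \<in> subsp k \<and> h \<notin> S. wt k S * of_bool (T \<subseteq> S))
    = of_bool (\<exists>V\<in>subsp k. T \<subseteq> V \<and> h \<notin> V)"
proof (cases "\<exists>V\<in>subsp k. T \<subseteq> V \<and> h \<notin> V")
  case True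
  then obtain V where V: "V \<in> subsp k" "T \<subseteq> V" "h \<notin> V" by blast
  obtain P where P: "P \<in> subsp k" "V \<subseteq> P" "h \<notin> P" "Wsp k = P \<union> vadd h ` P"
    using separating_hyperplane[OF V(1) h V(3)] by blast
  have TP: "T \<subseteq> P" using V P by auto
  show ?thesis
    using sum_avoiding_Int_hyperplane[OF P(1) h P(3,4), of "\<lambda>X. of_bool (T \<subseteq> X)"] TP True by simp
next
  case False
  then have "(\<Sum>S | S \<in> subsp k \<and> h \<notin> S. wt k S * of_bool (T \<subseteq> S)) = 0"
    by (intro sum.neutral) auto
  then show ?thesis using False by simp
qed

text \<open>The \<open>n\<close>-th power counts \<open>n\<close>-tuples from
  \<open>S \<inter> A\<close>. After exchanging the sums, each tuple contributes 1 exactly when its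
  span avoids \<open>h\<close>.\<close>

lemma moment_avoiding:
  assumes h: "h \<in> Wsp k" and A: "finite A"
  shows "(\<Sum>S | S \<in> subsp k \<and> h \<notin> S. wt k S * real (card (S \<inter> A)) ^ n)
    = card {xs. set xs \<subseteq> A \<and> length xs = n \<and> (\<exists>V\<in>subsp k. set xs \<subseteq> V \<and> h \<notin> V)}"
proof -
  let ?L = "{xs. set xs \<subseteq> A \<and> length xs = n}"
  have fin: "finite ?L" using A by (rule finite_lists_length_eq)
  have pow: "real (card (S \<inter> A)) ^ n = (\<Sum>xs\<in>?L. of_bool (set xs \<subseteq> S))" for S
  proof -
    have "card (S \<inter> A) ^ n = card {xs. set xs \<subseteq> S \<inter> A \<and> length xs = n}"
      using card_lists_length_eq[of "S \<inter> A" n] A by (metis finite_Int)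
    also have "{xs. set xs \<subseteq> S \<inter> A \<and> length xs = n} = ?L \<inter> {xs. set xs \<subseteq> S}" by auto
    finally have "real (card (S \<inter> A)) ^ n = card (?L \<inter> {xs. set xs \<subseteq> S})"
      by (metis of_nat_power)
    then show ?thesis using fin by simp
  qed
  have "(\<Sum>S | S \<in> subsp k \<and> h \<notin> S. wt k S * real (card (S \<inter> A)) ^ n)
      = (\<Sum>xs\<in>?L. \<Sum>S | S \<in> subsp k \<and> h \<notin> S. wt k S * of_bool (set xs \<subseteq> S))"
    unfolding pow sum_distrib_left by (rule sum.swap)
  also have "\<dots> = (\<Sum>xs\<in>?L. of_bool (\<exists>V\<in>subsp k. set xs \<subseteq> V \<and> h \<notin> V))"
    unfolding sum_avoiding_superset[OF h] ..
  also have "\<dots> = card (?L \<inter> {xs. \<exists>V\<in>subsp k. set xs \<subseteq> V \<and> h \<notin> V})"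
    using fin by simp
  also have "?L \<inter> {xs. \<exists>V\<in>subsp k. set xs \<subseteq> V \<and> h \<notin> V}
      = {xs. set xs \<subseteq> A \<and> length xs = n \<and> (\<exists>V\<in>subsp k. set xs \<subseteq> V \<and> h \<notin> V)}" by auto
  finally show ?thesis .
qed

text \<open>The factor \<open>n - 1\<close> comes from applying the operator
  \<open>t d/dt - 1\<close> to the exponential series.\<close>

lemma sums_minus_one_exp: "(\<lambda>n. (real n - 1) * (t ^ n / fact n)) sums ((t - 1) * exp t)" for t :: real
proof -
  have e: "(\<lambda>n. t ^ n / fact n) sums exp t"
    using exp_converges[of t] by (simp add: field_simps)
  have "(\<lambda>n. t * (t ^ n / fact n)) sums (t * exp t)" using e by (rule sums_mult)
  then have "(\<lambda>n. real (Suc n) * (t ^ Suc n / fact (Suc n))) sums (t * exp t)"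
    by (simp add: field_simps del: of_nat_Suc)
  then have "(\<lambda>n. real n * (t ^ n / fact n)) sums (t * exp t)"
    by (subst (asm) sums_Suc_iff) simp
  from sums_diff[OF this e] show ?thesis by (simp only: left_diff_distrib mult_1)
qed

text \<open>In the power series of \<open>(t - 1) exp t\<close> the constant term cancels the summand 1 and
  all later coefficients become counts of tuples whose span avoids \<open>h\<close>.\<close>

lemma curvature_positive:
  fixes c :: real
  assumes h: "h \<in> Wsp k" "h \<noteq> vzero" and A: "finite A" and a: "a \<in> A" "a \<in> Wsp k" "a \<noteq> h"
    and c: "c > 0"
  shows "1 + (\<Sum>S | S \<in> subsp k \<and> h \<notin> S.
      wt k S * ((c * card (S \<inter> A) - 1) * exp (c * card (S \<inter> A)))) > 0"
proof -
  let ?X = "{S. S \<in> subsp k \<and> h \<notin> S}"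
  let ?L = "\<lambda>n. {xs. set xs \<subseteq> A \<and> length xs = n \<and> (\<exists>V\<in>subsp k. set xs \<subseteq> V \<and> h \<notin> V)}"
  define f where "f n = (real n - 1) * (c ^ n / fact n) * card (?L n)" for n :: nat
  have "(\<lambda>n. \<Sum>S\<in>?X. wt k S * ((real n - 1) * ((c * card (S \<inter> A)) ^ n / fact n)))
      sums (\<Sum>S\<in>?X. wt k S * ((c * card (S \<inter> A) - 1) * exp (c * card (S \<inter> A))))"
    by (intro sums_sum sums_mult sums_minus_one_exp)
  moreover have "(\<Sum>S\<in>?X. wt k S * ((real n - 1) * ((c * card (S \<inter> A)) ^ n / fact n))) = f n" for n
    unfolding f_def moment_avoiding[OF h(1) A, symmetric] sum_distrib_left
    by (intro sum.cong refl) (simp add: power_mult_distrib)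
  ultimately have s: "f sums (\<Sum>S\<in>?X. wt k S * ((c * card (S \<inter> A) - 1) * exp (c * card (S \<inter> A))))"
    (is "_ sums ?s") by simp
  have "{vzero, a} \<in> subsp k" "h \<notin> {vzero, a}" using a h line_subsp by auto
  \<comment> \<open>The constant tuple spans only \<open>{vzero, a}\<close>, so every count is
    positive.\<close>
  then have mem: "replicate n a \<in> ?L n" for n using a by (auto intro!: bexI[of _ "{vzero, a}"])
  have fin: "finite (?L n)" for n
    by (rule finite_subset[OF _ finite_lists_length_eq[OF A, of n]]) auto
  have "?L 0 = {[]}" using mem[of 0] by auto
  then have f0: "f 0 = -1" by (simp add: f_def)
  have f1: "f 1 = 0" by (simp add: f_def)
  have "?L 2 \<noteq> {}" using mem[of 2] by (metis empty_iff)
  then have "card (?L 2) > 0" using fin[of 2] unfolding card_gt_0_iff by (rule conjI)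
  then have f2: "f 2 > 0" using c unfolding f_def by (intro mult_pos_pos divide_pos_pos) auto
  \<comment> \<open>The first three terms are -1, 0 and a positive number; all later ones are
    nonnegative.\<close>
  have "(\<Sum>n<3. f n) \<le> ?s" unfolding sums_unique[OF s]
  proof (rule sum_le_suminf[OF sums_summable[OF s]])
    fix n assume "n \<in> - {..<3::nat}"
    then show "0 \<le> f n" using c by (auto simp: f_def)
  qed simp
  moreover have "(\<Sum>n<3. f n) = f 0 + f 1 + f 2" by (simp add: eval_nat_numeral)
  ultimately show ?thesis using f0 f1 f2 by linarith
qed

section \<open>The excluded hyperplane and its transvections\<close>

text \<open>Coordinate \<open>k - 1\<close> is the leading bit. It separates the indices below
  \<open>2^(k-1)\<close> from the support of \<open>qcheck\<close>.\<close>

definition hyp0 :: "nat \<Rightarrow> (nat \<Rightarrow> bool) set" where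
  "hyp0 k = {v \<in> Wsp k. \<not> v (k - 1)}"

definition off0 :: "nat \<Rightarrow> (nat \<Rightarrow> bool) set" where
  "off0 k = {v \<in> Wsp k. v (k - 1)}"

lemma Wsp_split: "Wsp k = hyp0 k \<union> off0 k" "hyp0 k \<inter> off0 k = {}"
  by (auto simp: hyp0_def off0_def)

lemma finite_hyp0 [simp]: "finite (hyp0 k)" and finite_off0 [simp]: "finite (off0 k)"
  by (auto simp: hyp0_def off0_def)

lemma hyp0_subsp: "hyp0 k \<in> subsp k"
  using Wsp_subsp[of k] by (auto simp: hyp0_def subsp_def vadd_def)

lemma Wsp_vadd: "u \<in> Wsp k \<Longrightarrow> v \<in> Wsp k \<Longrightarrow> vadd u v \<in> Wsp k"
  using subspD(3)[OF Wsp_subsp] .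

lemma vadd_off0:
  assumes "a \<in> off0 k"
  shows "v \<in> hyp0 k \<Longrightarrow> vadd a v \<in> off0 k" and "v \<in> off0 k \<Longrightarrow> vadd a v \<in> hyp0 k"
  using assms Wsp_vadd[of a k v] by (auto simp: hyp0_def off0_def vadd_def)

lemma off0_Int_eq:
  assumes S: "S \<in> subsp k" and a: "a \<in> S \<inter> off0 k"
  shows "S \<inter> off0 k = vadd a ` (S \<inter> hyp0 k)"
proof (intro equalityI subsetI)
  fix v assume "v \<in> S \<inter> off0 k"
  then have "vadd a v \<in> S \<inter> hyp0 k"
    using a subspD(3)[OF S, of a v] vadd_off0(2)[of a k v] by auto
  then show "v \<in> vadd a ` (S \<inter> hyp0 k)" by (intro image_eqI[of _ _ "vadd a v"]) auto
next
  fix v assume "v \<in> vadd a ` (S \<inter> hyp0 k)"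
  then show "v \<in> S \<inter> off0 k"
    using a subspD(3)[OF S, of a] vadd_off0(1)[of a k] by auto
qed

text \<open>Translation by an element of \<open>S\<close> off the hyperplane exchanges the two
  halves of \<open>S\<close>.\<close>

lemma card_Int_off0:
  assumes S: "S \<in> subsp k" and "\<not> S \<subseteq> hyp0 k"
  shows "card (S \<inter> off0 k) = card (S \<inter> hyp0 k)"
proof -
  obtain a where "a \<in> S \<inter> off0 k"
    using assms subspD(1)[OF S] Wsp_split(1)[of k] by auto
  from off0_Int_eq[OF S this] show ?thesis by (simp add: card_image inj_vadd)
qed

lemma off0_nonempty: "k \<ge> 1 \<Longrightarrow> (\<lambda>j. j = k - 1) \<in> off0 k"
  by (auto simp: off0_def Wsp_def)

lemma card_hyp0_off0:
  assumes "k \<ge> 1"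
  shows "card (hyp0 k) = 2^(k-1)" "card (off0 k) = 2^(k-1)"
proof -
  have "\<not> Wsp k \<subseteq> hyp0 k" using off0_nonempty[OF assms] Wsp_split[of k] by auto
  from card_Int_off0[OF Wsp_subsp this] have eq: "card (off0 k) = card (hyp0 k)"
    using Wsp_split[of k] by (metis Int_absorb1 Un_upper1 Un_upper2)
  have "card (Wsp k) = card (hyp0 k) + card (off0 k)"
    using Wsp_split[of k] by (metis card_Un_disjoint finite_hyp0 finite_off0)
  moreover have "(2::nat)^k = 2 * 2^(k-1)" using assms by (metis Suc_diff_le diff_Suc_1 power_Suc One_nat_def)
  ultimately show "card (hyp0 k) = 2^(k-1)" "card (off0 k) = 2^(k-1)"
    using eq by (simp_all add: card_Wsp)
qed

lemma real_card_Int_eq_sum: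
  assumes "finite A"
  shows "real (card (S \<inter> A)) = (\<Sum>b\<in>A. of_bool (b \<in> S))"
  using assms by (simp add: Int_commute)

text \<open>Fix \<open>a\<close> off the hyperplane and sum over the subspaces avoiding
  \<open>a\<close>. Weighting by the part in \<open>hyp0 k\<close> gives
  \<open>card (hyp0 k)\<close>, by the part in \<open>off0 k\<close> one less than
  \<open>card (off0 k)\<close>. In the difference only subspaces of \<open>hyp0 k\<close> survive,
  as all others split evenly.\<close>

lemma sum_wt_card_hyp0:
  assumes k: "k \<ge> 1"
  shows "(\<Sum>S | S \<in> subsp k \<and> S \<subseteq> hyp0 k. wt k S * real (card S)) = 1"
proof -
  let ?H = "hyp0 k" and ?A = "off0 k"
  obtain a where a: "a \<in> ?A" using off0_nonempty[OF k] by blast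
  then have aW: "a \<in> Wsp k" and aH: "a \<notin> ?H" using Wsp_split[of k] by auto
  have a0: "a \<noteq> vzero" using a by (auto simp: off0_def)
  let ?X = "{S. S \<in> subsp k \<and> a \<notin> S}"
  have "Wsp k = ?H \<union> vadd a ` ?H"
    using off0_Int_eq[OF Wsp_subsp, of a k] a Wsp_split[of k] by (metis Int_absorb1 Int_iff Un_upper1 Un_upper2 aW)
  from sum_avoiding_Int_hyperplane[OF hyp0_subsp aW aH this, of "\<lambda>S. real (card S)"]
  have h: "(\<Sum>S\<in>?X. wt k S * real (card (S \<inter> ?H))) = card ?H" .
  have "(\<Sum>S\<in>?X. wt k S * real (card (S \<inter> ?A)))
      = (\<Sum>b\<in>?A. \<Sum>S\<in>?X. wt k S * of_bool ({b} \<subseteq> S))"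
    unfolding real_card_Int_eq_sum[OF finite_off0] sum_distrib_left by (subst sum.swap) simp
  also have "\<dots> = (\<Sum>b\<in>?A. of_bool (b \<noteq> a))"
  proof (rule sum.cong[OF refl], unfold sum_avoiding_superset[OF aW])
    fix b assume b: "b \<in> ?A"
    have "(\<exists>V\<in>subsp k. {b} \<subseteq> V \<and> a \<notin> V) \<longleftrightarrow> b \<noteq> a"
      using line_subsp[of b k] b a0 by (auto simp: off0_def intro!: bexI[of _ "{vzero, b}"])
    then show "of_bool (\<exists>V\<in>subsp k. {b} \<subseteq> V \<and> a \<notin> V) = of_bool (b \<noteq> a)" by simp
  qed
  also have "\<dots> = (\<Sum>b\<in>?A - {a}. 1)"
    by (rule sum.mono_neutral_cong_right) auto
  also have "\<dots> = real (card ?A) - 1"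
    using a card_hyp0_off0(2)[OF k] by (simp add: of_nat_diff)
  finally have A: "(\<Sum>S\<in>?X. wt k S * real (card (S \<inter> ?A))) = real (card ?A) - 1" .
  have "(\<Sum>S | S \<in> subsp k \<and> S \<subseteq> ?H. wt k S * real (card S))
      = (\<Sum>S\<in>?X. wt k S * real (card (S \<inter> ?H)) - wt k S * real (card (S \<inter> ?A)))"
  proof (rule sum.mono_neutral_cong_left)
    show "\<forall>S\<in>?X - {S. S \<in> subsp k \<and> S \<subseteq> ?H}. wt k S * real (card (S \<inter> ?H)) - wt k S * real (card (S \<inter> ?A)) = 0"
      using card_Int_off0 by auto
    fix S assume "S \<in> {S. S \<in> subsp k \<and> S \<subseteq> ?H}"
    then have "S \<inter> ?H = S" "S \<inter> ?A = {}" using Wsp_split[of k] by auto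
    then show "wt k S * real (card S) = wt k S * real (card (S \<inter> ?H)) - wt k S * real (card (S \<inter> ?A))"
      by simp
  qed (use aH in auto)
  then show ?thesis using h A card_hyp0_off0[OF k] by (simp add: sum_subtractf)
qed

section \<open>Transvections and the sums they preserve\<close>

definition transv :: "((nat \<Rightarrow> bool) \<Rightarrow> bool) \<Rightarrow> (nat \<Rightarrow> bool) \<Rightarrow> (nat \<Rightarrow> bool) \<Rightarrow> nat \<Rightarrow> bool" where
  "transv f w v = (if f v then vadd v w else v)"

text \<open>With \<open>c = lam / 2^(k-1)\<close> the exponent is
  \<open>lam * zeta k S (qcheck k)\<close>, so these are the terms of the loss at
  \<open>qcheck\<close>, up to a common factor.\<close>

definition ew :: "nat \<Rightarrow> real \<Rightarrow> (nat \<Rightarrow> bool) set \<Rightarrow> real" where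
  "ew k c S = wt k S * exp (c * real (card (S \<inter> off0 k)))"

text \<open>Here \<open>f\<close> is a linear functional written as a predicate. The transvection is
  then a linear involution that preserves \<open>off0 k\<close>, so it permutes the subspaces and
  keeps cardinality and the trace on \<open>off0 k\<close>, hence \<open>ew\<close>.\<close>

lemma sum_ew_transv:
  assumes w: "w \<in> hyp0 k" "\<not> f w"
    and f: "\<And>u v. u \<in> Wsp k \<Longrightarrow> v \<in> Wsp k \<Longrightarrow> f (vadd u v) \<longleftrightarrow> f u \<noteq> f v"
    and I: "I \<subseteq> Wsp k" and J: "J \<subseteq> Wsp k"
  shows "(\<Sum>S | S \<in> subsp k \<and> I \<subseteq> S \<and> J \<inter> S = {}. ew k c S)
    = (\<Sum>S | S \<in> subsp k \<and> transv f w ` I \<subseteq> S \<and> transv f w ` J \<inter> S = {}. ew k c S)"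
proof -
  let ?t = "transv f w"
  have wW: "w \<in> Wsp k" using w by (simp add: hyp0_def)
  have tW: "?t v \<in> Wsp k" if "v \<in> Wsp k" for v
    using that wW Wsp_vadd by (auto simp: transv_def)
  \<comment> \<open>Since \<open>f w\<close> is false, adding \<open>w\<close> does not change the
    value of \<open>f\<close>, and the second application adds \<open>w\<close> again.\<close>
  have tt: "?t (?t v) = v" if "v \<in> Wsp k" for v
    using that wW w(2) f[of v w] by (auto simp: transv_def vadd_ac)
  have tadd: "?t (vadd u v) = vadd (?t u) (?t v)" if "u \<in> Wsp k" "v \<in> Wsp k" for u v
    using that f[of u v] by (auto simp: transv_def vadd_ac)
  have toff: "?t v \<in> off0 k \<longleftrightarrow> v \<in> off0 k" if "v \<in> Wsp k" for v
    using that w tW[OF that] by (auto simp: transv_def off0_def hyp0_def vadd_def)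
  have ttS: "?t ` ?t ` S = S" if "S \<subseteq> Wsp k" for S
  proof -
    have "?t ` ?t ` S = (\<lambda>v. v) ` S"
      unfolding image_image using that tt by (intro image_cong refl) auto
    then show ?thesis by simp
  qed
  have tS: "?t ` S \<in> subsp k" if S: "S \<in> subsp k" for S
  proof -
    note SD = subspD[OF S]
    have "?t vzero = vzero" using f[of vzero vzero] subspD(2)[OF Wsp_subsp, of k] by (simp add: transv_def)
    then have "vzero \<in> ?t ` S" using SD(2) by force
    moreover have "vadd (?t u) (?t v) \<in> ?t ` S" if "u \<in> S" "v \<in> S" for u v
      using that SD tadd[of u v] by (metis image_eqI subsetD)
    ultimately show ?thesis using SD(1) tW by (auto simp: subsp_def)
  qed
  have inj: "inj_on ?t (Wsp k)" using tt by (metis inj_onI)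
  have card_t: "card (?t ` S) = card S" if "S \<subseteq> Wsp k" for S
    using inj_on_subset[OF inj that] by (rule card_image)
  have ew_t: "ew k c (?t ` S) = ew k c S" if "S \<in> subsp k" for S
  proof -
    have SW: "S \<subseteq> Wsp k" using subspD(1)[OF that] .
    have "?t ` S \<inter> off0 k = ?t ` (S \<inter> off0 k)" using SW toff by blast
    moreover have "card (?t ` (S \<inter> off0 k)) = card (S \<inter> off0 k)" using SW by (intro card_t) auto
    ultimately show ?thesis using card_t[OF SW] by (simp add: ew_def wt_def cod_def)
  qed
  have mem: "?t v \<in> ?t ` S \<longleftrightarrow> v \<in> S" if "v \<in> Wsp k" "S \<subseteq> Wsp k" for v S
    using inj that by (metis inj_on_image_mem_iff)
  have iff1: "?t ` I \<subseteq> ?t ` S \<longleftrightarrow> I \<subseteq> S" if "S \<subseteq> Wsp k" for S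
    using I mem[OF _ that] by blast
  have iff2: "?t ` J \<inter> ?t ` S = {} \<longleftrightarrow> J \<inter> S = {}" if "S \<subseteq> Wsp k" for S
    using J mem[OF _ that] by blast
  show ?thesis
  proof (rule sum.reindex_bij_witness[where i = "image ?t" and j = "image ?t"])
    fix S assume S: "S \<in> {S. S \<in> subsp k \<and> I \<subseteq> S \<and> J \<inter> S = {}}"
    then have SW: "S \<subseteq> Wsp k" and Ss: "S \<in> subsp k" using subspD(1) by auto
    show "?t ` ?t ` S = S" by (rule ttS[OF SW])
    show "?t ` S \<in> {S. S \<in> subsp k \<and> ?t ` I \<subseteq> S \<and> ?t ` J \<inter> S = {}}"
      using S iff1[OF SW] iff2[OF SW] tS[OF Ss] by simp
    show "ew k c (?t ` S) = ew k c S" by (rule ew_t[OF Ss])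
  next
    fix S assume S: "S \<in> {S. S \<in> subsp k \<and> ?t ` I \<subseteq> S \<and> ?t ` J \<inter> S = {}}"
    then have SW: "S \<subseteq> Wsp k" and Ss: "S \<in> subsp k" using subspD(1) by auto
    show "?t ` ?t ` S = S" by (rule ttS[OF SW])
    have "?t ` S \<subseteq> Wsp k" using SW tW by auto
    from iff1[OF this] iff2[OF this] show "?t ` S \<in> {S. S \<in> subsp k \<and> I \<subseteq> S \<and> J \<inter> S = {}}"
      using S tS[OF Ss] ttS[OF SW] by simp
  qed
qed

text \<open>The functional is the leading coordinate, whose kernel \<open>hyp0 k\<close> is
  therefore fixed pointwise.\<close>

lemma off0_transv:
  assumes i: "i \<in> off0 k" "j \<in> off0 k"
  obtains f w where "w \<in> hyp0 k" "\<not> f w"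
    "\<And>u v. u \<in> Wsp k \<Longrightarrow> v \<in> Wsp k \<Longrightarrow> f (vadd u v) \<longleftrightarrow> f u \<noteq> f v"
    "transv f w i = j" "\<And>h. h \<in> hyp0 k \<Longrightarrow> transv f w h = h"
proof (rule that[of "vadd i j" "\<lambda>v. v (k - 1)"])
  show "vadd i j \<in> hyp0 k" by (rule vadd_off0(2)[OF i])
qed (use i in \<open>auto simp: vadd_def transv_def off0_def hyp0_def\<close>)

text \<open>The functional must vanish on \<open>h + g\<close> but not on \<open>h\<close>. A
  hyperplane through \<open>h + g\<close> avoiding \<open>h\<close> serves as its kernel.\<close>

lemma hyp0_transv:
  assumes h: "h \<in> hyp0 k" "h \<noteq> vzero" and g: "g \<in> hyp0 k" "g \<noteq> vzero"
  obtains f w where "w \<in> hyp0 k" "\<not> f w"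
    "\<And>u v. u \<in> Wsp k \<Longrightarrow> v \<in> Wsp k \<Longrightarrow> f (vadd u v) \<longleftrightarrow> f u \<noteq> f v"
    "transv f w h = g"
proof -
  let ?w = "vadd h g"
  have wH: "?w \<in> hyp0 k" using subspD(3)[OF hyp0_subsp] h g by auto
  have W: "h \<in> Wsp k" "?w \<in> Wsp k" using h wH by (auto simp: hyp0_def)
  have "h \<noteq> ?w" using g(2) by (metis vadd_simps(3) vadd_left_cancel)
  then have "h \<notin> {vzero, ?w}" using h by auto
  then obtain P where P: "P \<in> subsp k" "{vzero, ?w} \<subseteq> P" "h \<notin> P" "Wsp k = P \<union> vadd h ` P"
    using separating_hyperplane[OF line_subsp[OF W(2)] W(1)] by blast
  have odd: "vadd u v \<in> P" if uv: "u \<in> Wsp k" "v \<in> Wsp k" "u \<notin> P" "v \<notin> P" for u v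
  proof -
    obtain p q where "u = vadd h p" "v = vadd h q" "p \<in> P" "q \<in> P"
      using uv unfolding P(4) by auto
    then show ?thesis using subspD(3)[OF P(1), of p q] by (simp add: vadd_ac)
  qed
  show thesis
  proof (rule that[of ?w "\<lambda>v. v \<notin> P"])
    show "(vadd u v \<notin> P) \<longleftrightarrow> (u \<notin> P) \<noteq> (v \<notin> P)" if uv: "u \<in> Wsp k" "v \<in> Wsp k" for u v
      using odd[OF uv] subsp_vadd_iff[OF P(1)] by blast
  qed (use wH P in \<open>auto simp: transv_def\<close>)
qed

text \<open>Double counting of the pairs \<open>v \<in> S\<close>, used to average over an
  orbit.\<close>

lemma sum_ew_incidence:
  assumes "finite A"
  shows "(\<Sum>v\<in>A. \<Sum>S | S \<in> subsp k \<and> v \<in> S \<and> Q S. ew k c S)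
    = (\<Sum>S | S \<in> subsp k \<and> Q S. ew k c S * real (card (S \<inter> A)))"
proof -
  have "(\<Sum>S | S \<in> subsp k \<and> v \<in> S \<and> Q S. ew k c S)
      = (\<Sum>S | S \<in> subsp k \<and> Q S. ew k c S * of_bool (v \<in> S))" for v
    by (rule sum.mono_neutral_cong_left) auto
  then have "(\<Sum>v\<in>A. \<Sum>S | S \<in> subsp k \<and> v \<in> S \<and> Q S. ew k c S)
      = (\<Sum>v\<in>A. \<Sum>S | S \<in> subsp k \<and> Q S. ew k c S * of_bool (v \<in> S))" by simp
  also have "\<dots> = (\<Sum>S | S \<in> subsp k \<and> Q S. \<Sum>v\<in>A. ew k c S * of_bool (v \<in> S))"
    by (rule sum.swap)
  finally show ?thesis unfolding real_card_Int_eq_sum[OF assms] sum_distrib_left .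
qed

text \<open>Only subspaces of \<open>hyp0 k\<close> contribute, and there the exponential factor is
  1, so the value is independent of \<open>c\<close>.\<close>

lemma sum_ew_card_diff:
  assumes "k \<ge> 1"
  shows "(\<Sum>S\<in>subsp k. ew k c S * (real (card (S \<inter> hyp0 k)) - real (card (S \<inter> off0 k)))) = 1"
proof -
  have "(\<Sum>S | S \<in> subsp k \<and> S \<subseteq> hyp0 k. wt k S * real (card S))
      = (\<Sum>S\<in>subsp k. ew k c S * (real (card (S \<inter> hyp0 k)) - real (card (S \<inter> off0 k))))"
  proof (rule sum.mono_neutral_cong_left)
    fix S assume "S \<in> {S. S \<in> subsp k \<and> S \<subseteq> hyp0 k}"
    then have "S \<inter> hyp0 k = S" "S \<inter> off0 k = {}" using Wsp_split[of k] by auto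
    then show "wt k S * real (card S)
        = ew k c S * (real (card (S \<inter> hyp0 k)) - real (card (S \<inter> off0 k)))"
      by (simp add: ew_def)
  qed (use card_Int_off0 in auto)
  then show ?thesis using sum_wt_card_hyp0[OF assms] by simp
qed

text \<open>\<open>dA\<close> and \<open>dH\<close> are, up to a common factor, the partial derivatives of the loss at \<open>qcheck\<close>,
  and \<open>dA\<close>, \<open>dA - E\<close> the entries of its Hessian on the coordinates of \<open>off0 k\<close>.\<close>

lemma curvature_constants:
  assumes k: "k \<ge> 2" and c: "c > 0"
  obtains dA dH E where
    "\<And>i. i \<in> off0 k \<Longrightarrow> (\<Sum>S | S \<in> subsp k \<and> i \<in> S. ew k c S) = dA"
    "\<And>h. h \<in> hyp0 k \<Longrightarrow> h \<noteq> vzero \<Longrightarrow> (\<Sum>S | S \<in> subsp k \<and> h \<in> S. ew k c S) = dH"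
    "\<And>i j. i \<in> off0 k \<Longrightarrow> j \<in> off0 k \<Longrightarrow> i \<noteq> j \<Longrightarrow>
      (\<Sum>S | S \<in> subsp k \<and> i \<in> S \<and> j \<in> S. ew k c S) = dA - E"
    "dH - dA + c * E > 0"
proof -
  let ?H = "hyp0 k" and ?A = "off0 k"
  define D where "D v = (\<Sum>S | S \<in> subsp k \<and> v \<in> S. ew k c S)" for v
  \<comment> \<open>Its common value over \<open>i\<close> in \<open>off0 k\<close> and nonzero
    \<open>h\<close> in \<open>hyp0 k\<close> will be \<open>E\<close>.\<close>
  define F where "F i h = (\<Sum>S | S \<in> subsp k \<and> i \<in> S \<and> h \<notin> S. ew k c S)" for i h
  have HW: "v \<in> Wsp k" if "v \<in> ?H" for v using that by (simp add: hyp0_def)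
  have AW: "v \<in> Wsp k" if "v \<in> ?A" for v using that by (simp add: off0_def)
  obtain a where a: "a \<in> ?A" using off0_nonempty[of k] k by auto
  obtain h where h: "h \<in> ?H" "h \<noteq> vzero"
  proof
    show "(\<lambda>j. j = 0) \<in> ?H" using k by (auto simp: hyp0_def Wsp_def)
    show "(\<lambda>j::nat. j = 0) \<noteq> vzero" by (auto simp: fun_eq_iff)
  qed
  have DA: "D i = D a" if "i \<in> ?A" for i
  proof (rule off0_transv[OF that a])
    fix f w
    assume *: "w \<in> ?H" "\<not> f w" "\<And>u v. u \<in> Wsp k \<Longrightarrow> v \<in> Wsp k \<Longrightarrow> f (vadd u v) \<longleftrightarrow> f u \<noteq> f v"
      and t: "transv f w i = a"
    show ?thesis
      using sum_ew_transv[where f = f and w = w and I = "{i}" and J = "{}" and c = c, OF *] AW[OF that] t by (simp add: D_def)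
  qed
  have DH: "D g = D h" if "g \<in> ?H" "g \<noteq> vzero" for g
  proof (rule hyp0_transv[OF that h])
    fix f w
    assume *: "w \<in> ?H" "\<not> f w" "\<And>u v. u \<in> Wsp k \<Longrightarrow> v \<in> Wsp k \<Longrightarrow> f (vadd u v) \<longleftrightarrow> f u \<noteq> f v"
      and t: "transv f w g = h"
    show ?thesis
      using sum_ew_transv[where f = f and w = w and I = "{g}" and J = "{}" and c = c, OF *] HW[OF that(1)] t by (simp add: D_def)
  qed
  have F1: "F i g = F j g" if "i \<in> ?A" "j \<in> ?A" "g \<in> ?H" for i j g
  proof (rule off0_transv[OF that(1,2)])
    fix f w
    assume *: "w \<in> ?H" "\<not> f w" "\<And>u v. u \<in> Wsp k \<Longrightarrow> v \<in> Wsp k \<Longrightarrow> f (vadd u v) \<longleftrightarrow> f u \<noteq> f v"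
      and t: "transv f w i = j" "\<And>h. h \<in> ?H \<Longrightarrow> transv f w h = h"
    show ?thesis
      using sum_ew_transv[where f = f and w = w and I = "{i}" and J = "{g}" and c = c, OF *] AW[OF that(1)] HW[OF that(3)] t that(3)
      by (simp add: F_def)
  qed
  \<comment> \<open>First move \<open>g\<close> to \<open>h\<close>, which keeps \<open>i\<close> in
    \<open>off0 k\<close>; then move \<open>i\<close> to \<open>a\<close> while fixing
    \<open>h\<close>.\<close>
  have F2: "F i g = F a h" if ig: "i \<in> ?A" "g \<in> ?H" "g \<noteq> vzero" for i g
  proof (rule hyp0_transv[OF ig(2,3) h])
    fix f w
    assume *: "w \<in> ?H" "\<not> f w" "\<And>u v. u \<in> Wsp k \<Longrightarrow> v \<in> Wsp k \<Longrightarrow> f (vadd u v) \<longleftrightarrow> f u \<noteq> f v"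
      and t: "transv f w g = h"
    have A: "transv f w i \<in> ?A" using vadd_off0(1)[OF ig(1) *(1)] ig(1) by (auto simp: transv_def)
    have "F i g = F (transv f w i) h"
      using sum_ew_transv[where f = f and w = w and I = "{i}" and J = "{g}" and c = c, OF *] AW[OF ig(1)] HW[OF ig(2)] t by (simp add: F_def)
    also have "\<dots> = F a h" using F1[OF A a h(1)] .
    finally show ?thesis .
  qed
  define m where "m = (2::real)^(k-1)"
  have m: "real (card ?H) = m" "real (card ?A) = m" "m > 0"
    using card_hyp0_off0[of k] k by (auto simp: m_def)
  let ?U = "\<Sum>S | S \<in> subsp k \<and> h \<notin> S. ew k c S"
  have mA: "m * D a = (\<Sum>S\<in>subsp k. ew k c S * real (card (S \<inter> ?A)))"
  proof -
    have "(\<Sum>v\<in>?A. D v) = (\<Sum>v\<in>?A. D a)" by (intro sum.cong refl DA)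
    then have "(\<Sum>v\<in>?A. D v) = m * D a" using m by simp
    then show ?thesis using sum_ew_incidence[where A = ?A and k = k and Q = "\<lambda>_. True" and c = c] by (simp add: D_def)
  qed
  \<comment> \<open>The zero vector lies in every subspace, so it is removed before averaging over
    the \<open>m - 1\<close> nonzero vectors.\<close>
  have mH: "(m - 1) * D h = (\<Sum>S\<in>subsp k. ew k c S * (real (card (S \<inter> ?H)) - 1))"
  proof -
    have z: "vzero \<in> ?H" using subspD(2)[OF hyp0_subsp] .
    have "(\<Sum>v\<in>?H - {vzero}. D v) = (\<Sum>v\<in>?H - {vzero}. D h)"
      by (intro sum.cong refl DH) auto
    moreover have "real (card (?H - {vzero})) = m - 1"
      using z card_hyp0_off0(1)[of k] k by (simp add: m_def of_nat_diff)
    ultimately have "(\<Sum>v\<in>?H - {vzero}. D v) = (m - 1) * D h" by simp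
    moreover have "(\<Sum>v\<in>?H - {vzero}. D v)
        = (\<Sum>S\<in>subsp k. ew k c S * real (card (S \<inter> (?H - {vzero}))))"
      using sum_ew_incidence[where A = "?H - {vzero}" and k = k and Q = "\<lambda>_. True" and c = c] by (simp add: D_def)
    moreover have "real (card (S \<inter> (?H - {vzero}))) = real (card (S \<inter> ?H)) - 1" if "S \<in> subsp k" for S
    proof -
      have "vzero \<in> S \<inter> ?H" using z subspD(2)[OF that] by auto
      then have "card (S \<inter> ?H) > 0" by (auto simp: card_gt_0_iff)
      moreover have "S \<inter> (?H - {vzero}) = S \<inter> ?H - {vzero}" by auto
      ultimately show ?thesis using \<open>vzero \<in> S \<inter> ?H\<close> by (simp add: of_nat_diff Suc_le_eq)
    qed
    ultimately show ?thesis by simp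
  qed
  have U: "?U = (\<Sum>S\<in>subsp k. ew k c S) - D h"
  proof -
    have "(\<Sum>S\<in>subsp k. ew k c S) = ?U + D h"
      unfolding D_def by (subst sum.union_disjoint[symmetric]) (auto intro!: sum.cong)
    then show ?thesis by simp
  qed
  have "(m - 1) * D h - m * D a = 1 - (\<Sum>S\<in>subsp k. ew k c S)"
    using mA mH sum_ew_card_diff[where k = k and c = c] k
    by (simp add: sum_subtractf algebra_simps)
  \<comment> \<open>Moving one \<open>D h\<close> to the right turns the sum over all subspaces into
    the sum over those avoiding \<open>h\<close>.\<close>
  then have gap: "m * (D h - D a) = 1 - ?U" unfolding U by (simp add: algebra_simps)
  have "m * F a h = (\<Sum>v\<in>?A. F v h)"
  proof -
    have "(\<Sum>v\<in>?A. F v h) = (\<Sum>v\<in>?A. F a h)" using F2 h by (intro sum.cong refl) auto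
    then show ?thesis using m by simp
  qed
  also have "\<dots> = (\<Sum>S | S \<in> subsp k \<and> h \<notin> S. ew k c S * real (card (S \<inter> ?A)))"
    unfolding F_def by (rule sum_ew_incidence) simp
  finally have mF: "m * F a h = \<dots>" .
  \<comment> \<open>The last term is \<open>c\<close> times the derivative of \<open>?U\<close> in
    \<open>c\<close>.\<close>
  have "m * (D h - D a + c * F a h) = 1 - ?U + c * (m * F a h)"
    using gap by (simp add: algebra_simps)
  also have "\<dots> = 1 + (\<Sum>S | S \<in> subsp k \<and> h \<notin> S.
      wt k S * ((c * card (S \<inter> ?A) - 1) * exp (c * card (S \<inter> ?A))))"
    unfolding mF sum_distrib_left by (simp add: ew_def algebra_simps sum_subtractf)
  also have "\<dots> > 0"
  proof (rule curvature_positive[OF HW[OF h(1)] h(2) finite_off0 a AW[OF a] _ c])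
    show "a \<noteq> h" using a h by (auto simp: off0_def hyp0_def)
  qed
  finally have pos: "D h - D a + c * F a h > 0" using m(3) by (simp add: zero_less_mult_iff)
  have "(\<Sum>S | S \<in> subsp k \<and> i \<in> S \<and> j \<in> S. ew k c S) = D a - F a h"
    if i: "i \<in> ?A" and j: "j \<in> ?A" and ij: "i \<noteq> j" for i j
  proof -
    \<comment> \<open>A subspace containing \<open>i\<close> avoids \<open>j\<close> exactly when it
      avoids \<open>i + j\<close>, a nonzero vector of the hyperplane.\<close>
    have g: "vadd i j \<in> ?H" "vadd i j \<noteq> vzero" using vadd_off0(2)[OF i j] ij by auto
    have "F i (vadd i j) = (\<Sum>S | S \<in> subsp k \<and> i \<in> S \<and> j \<notin> S. ew k c S)"
      unfolding F_def using subsp_vadd_iff(1) by (intro sum.cong refl) blast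
    moreover have "D i = (\<Sum>S | S \<in> subsp k \<and> i \<in> S \<and> j \<in> S. ew k c S)
        + (\<Sum>S | S \<in> subsp k \<and> i \<in> S \<and> j \<notin> S. ew k c S)"
      unfolding D_def by (subst sum.union_disjoint[symmetric]) (auto intro!: sum.cong)
    ultimately show ?thesis using F2[OF i g] DA[OF i] by simp
  qed
  then show thesis using that[of "D a" "D h" "F a h"] DA DH pos unfolding D_def by blast
qed

section \<open>Second-order expansion\<close>

text \<open>The Lagrange remainder is \<open>exp u / 6 * t ^ 3\<close>, and \<open>exp u\<close> is
  at most 3.\<close>

lemma exp_taylor_cubic:
  fixes t :: real
  assumes "\<bar>t\<bar> \<le> 1"
  shows "\<bar>exp t - 1 - t - t\<^sup>2 / 2\<bar> \<le> \<bar>t\<bar> ^ 3"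
proof -
  obtain u where u: "\<bar>u\<bar> \<le> \<bar>t\<bar>" and e: "exp t = (\<Sum>m<3. t ^ m / fact m) + exp u / fact 3 * t ^ 3"
    using Maclaurin_exp_le[of t 3] by blast
  have eq: "exp t - 1 - t - t\<^sup>2 / 2 = exp u / 6 * t ^ 3"
    using e by (simp add: eval_nat_numeral)
  have "exp u \<le> 6"
  proof -
    have "exp u \<le> exp 1" using u assms by simp
    also have "\<dots> \<le> 3" by (rule exp_le)
    finally show ?thesis by simp
  qed
  then show ?thesis
    unfolding eq using mult_right_mono[of "exp u / 6" 1 "\<bar>t ^ 3\<bar>"] by (simp add: abs_mult power_abs)
qed

text \<open>Exempting points with \<open>z v = 0\<close> lets the lemma apply to
  \<open>hyp0 k\<close> although the zero vector has a different incidence sum.\<close>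

lemma sum_ew_linear:
  assumes "A \<subseteq> Wsp k" and "\<And>v. v \<in> A \<Longrightarrow> z v \<noteq> 0 \<Longrightarrow> (\<Sum>S | S \<in> subsp k \<and> v \<in> S. ew k c S) = d"
  shows "(\<Sum>S\<in>subsp k. ew k c S * (\<Sum>v\<in>S \<inter> A. z v)) = d * (\<Sum>v\<in>A. z v)"
proof -
  have fin: "finite A" by (rule finite_subset[OF assms(1) finite_Wsp])
  have "(\<Sum>S\<in>subsp k. ew k c S * (\<Sum>v\<in>S \<inter> A. z v))
      = (\<Sum>S\<in>subsp k. \<Sum>v\<in>A. z v * (ew k c S * of_bool (v \<in> S)))"
    unfolding sum_distrib_left using fin
    by (intro sum.cong refl sum.mono_neutral_cong_left) auto
  also have "\<dots> = (\<Sum>v\<in>A. z v * (\<Sum>S\<in>subsp k. ew k c S * of_bool (v \<in> S)))"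
    unfolding sum_distrib_left by (rule sum.swap)
  also have "\<dots> = (\<Sum>v\<in>A. z v * d)"
  proof (rule sum.cong[OF refl])
    fix v assume v: "v \<in> A"
    have "(\<Sum>S\<in>subsp k. ew k c S * of_bool (v \<in> S)) = (\<Sum>S | S \<in> subsp k \<and> v \<in> S. ew k c S)"
      by (rule sum.mono_neutral_cong_right) auto
    then show "z v * (\<Sum>S\<in>subsp k. ew k c S * of_bool (v \<in> S)) = z v * d"
      using assms(2)[OF v] by (cases "z v = 0") auto
  qed
  finally show ?thesis by (simp add: sum_distrib_left mult.commute)
qed

text \<open>The matrix of this form is \<open>e\<close> times the identity plus \<open>d - e\<close>
  times the all-ones matrix.\<close>

lemma sum_ew_quadratic:
  assumes "finite A" and "\<And>i. i \<in> A \<Longrightarrow> (\<Sum>S | S \<in> subsp k \<and> i \<in> S. ew k c S) = d"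
    and "\<And>i j. i \<in> A \<Longrightarrow> j \<in> A \<Longrightarrow> i \<noteq> j \<Longrightarrow>
      (\<Sum>S | S \<in> subsp k \<and> i \<in> S \<and> j \<in> S. ew k c S) = d - e"
  shows "(\<Sum>S\<in>subsp k. ew k c S * (\<Sum>v\<in>S \<inter> A. z v)\<^sup>2)
    = e * (\<Sum>v\<in>A. (z v)\<^sup>2) + (d - e) * (\<Sum>v\<in>A. z v)\<^sup>2"
proof -
  have sq: "(\<Sum>v\<in>S \<inter> A. z v)\<^sup>2 = (\<Sum>i\<in>A. \<Sum>j\<in>A. z i * z j * of_bool (i \<in> S \<and> j \<in> S))" for S
  proof -
    have "(\<Sum>v\<in>S \<inter> A. z v) = (\<Sum>v\<in>A. z v * of_bool (v \<in> S))"
      using assms(1) by (intro sum.mono_neutral_cong_left) auto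
    then show ?thesis
      by (simp add: power2_eq_square sum_product of_bool_conj algebra_simps)
  qed
  have "(\<Sum>S\<in>subsp k. ew k c S * (\<Sum>v\<in>S \<inter> A. z v)\<^sup>2)
      = (\<Sum>S\<in>subsp k. \<Sum>i\<in>A. \<Sum>j\<in>A. z i * z j * (ew k c S * of_bool (i \<in> S \<and> j \<in> S)))"
    unfolding sq sum_distrib_left by (intro sum.cong refl) (simp add: algebra_simps)
  also have "\<dots> = (\<Sum>i\<in>A. \<Sum>S\<in>subsp k. \<Sum>j\<in>A. z i * z j * (ew k c S * of_bool (i \<in> S \<and> j \<in> S)))"
    by (rule sum.swap)
  also have "\<dots> = (\<Sum>i\<in>A. \<Sum>j\<in>A. z i * z j * (\<Sum>S\<in>subsp k. ew k c S * of_bool (i \<in> S \<and> j \<in> S)))"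
    unfolding sum_distrib_left by (intro sum.cong refl sum.swap)
  also have "\<dots> = (\<Sum>i\<in>A. \<Sum>j\<in>A. z i * z j * (d - e) + (if j = i then e * (z i)\<^sup>2 else 0))"
  proof (intro sum.cong refl)
    fix i j assume ij: "i \<in> A" "j \<in> A"
    have "(\<Sum>S\<in>subsp k. ew k c S * of_bool (i \<in> S \<and> j \<in> S))
        = (\<Sum>S | S \<in> subsp k \<and> i \<in> S \<and> j \<in> S. ew k c S)"
      by (rule sum.mono_neutral_cong_right) auto
    also have "\<dots> = (if j = i then d else d - e)" using assms(2,3) ij by auto
    finally show "z i * z j * (\<Sum>S\<in>subsp k. ew k c S * of_bool (i \<in> S \<and> j \<in> S))
        = z i * z j * (d - e) + (if j = i then e * (z i)\<^sup>2 else 0)"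
      by (simp add: algebra_simps power2_eq_square)
  qed
  also have "\<dots> = (\<Sum>i\<in>A. \<Sum>j\<in>A. z i * z j * (d - e)) + (\<Sum>i\<in>A. e * (z i)\<^sup>2)"
    using assms(1) by (simp add: sum.distrib)
  also have "(\<Sum>i\<in>A. \<Sum>j\<in>A. z i * z j * (d - e)) = (d - e) * (\<Sum>v\<in>A. z v)\<^sup>2"
    by (simp add: power2_eq_square sum_product sum_distrib_left algebra_simps)
  finally show ?thesis by (simp add: sum_distrib_left algebra_simps)
qed

lemma sum_power2_le_power2_sum:
  fixes z :: "'a \<Rightarrow> real"
  assumes "finite A" "\<And>v. v \<in> A \<Longrightarrow> z v \<ge> 0"
  shows "(\<Sum>v\<in>A. (z v)\<^sup>2) \<le> (\<Sum>v\<in>A. z v)\<^sup>2"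
proof -
  have "(\<Sum>v\<in>A. (z v)\<^sup>2) \<le> (\<Sum>v\<in>A. z v * (\<Sum>u\<in>A. z u))"
    unfolding power2_eq_square
    using assms by (intro sum_mono mult_left_mono member_le_sum) auto
  then show ?thesis by (simp add: power2_eq_square sum_distrib_right)
qed

lemma abs_le_sqrt_sum_squares:
  fixes z :: "'a \<Rightarrow> real"
  assumes "finite W" "v \<in> W"
  shows "\<bar>z v\<bar> \<le> sqrt (\<Sum>v\<in>W. (z v)\<^sup>2)"
  using member_le_sum[of v W "\<lambda>v. (z v)\<^sup>2"] assms by (intro real_le_rsqrt) auto

text \<open>The radius constraint makes the mass moved onto the excluded hyperplane quadratic in the
  displacement, so the first-order term competes with the second-order one, and only the
  combination \<open>dH - dA + c * E\<close> matters.\<close>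

lemma second_order_min:
  fixes lam :: real
  assumes k: "k \<ge> 2" and lam: "lam > 0"
  defines "m \<equiv> (2::real)^(k-1)"
  shows "\<exists>r>0. \<forall>z. z vzero = 0 \<longrightarrow> (\<forall>v\<in>hyp0 k. z v \<ge> 0) \<longrightarrow> (\<Sum>v\<in>Wsp k. z v) = 0 \<longrightarrow>
      (\<Sum>v\<in>hyp0 k. z v) = m / 2 * (\<Sum>v\<in>Wsp k. (z v)\<^sup>2) \<longrightarrow>
      sqrt (\<Sum>v\<in>Wsp k. (z v)\<^sup>2) < r \<longrightarrow>
      (\<Sum>S\<in>subsp k. ew k (lam / m) S)
        \<le> (\<Sum>S\<in>subsp k. ew k (lam / m) S * exp (lam * (\<Sum>v\<in>S. z v)))"
proof -
  define c where "c = lam / m"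
  have m0: "m > 0" by (simp add: m_def)
  have c0: "c > 0" using lam m0 by (simp add: c_def)
  have cm: "c * m = lam" using m0 by (simp add: c_def)
  let ?H = "hyp0 k" and ?A = "off0 k" and ?w = "ew k c"
  obtain dA dH E where
    dA: "\<And>i. i \<in> ?A \<Longrightarrow> (\<Sum>S | S \<in> subsp k \<and> i \<in> S. ?w S) = dA"
    and dH: "\<And>h. h \<in> ?H \<Longrightarrow> h \<noteq> vzero \<Longrightarrow> (\<Sum>S | S \<in> subsp k \<and> h \<in> S. ?w S) = dH"
    and dE: "\<And>i j. i \<in> ?A \<Longrightarrow> j \<in> ?A \<Longrightarrow> i \<noteq> j \<Longrightarrow>
      (\<Sum>S | S \<in> subsp k \<and> i \<in> S \<and> j \<in> S. ?w S) = dA - E"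
    and pos: "dH - dA + c * E > 0"
    using curvature_constants[OF k c0] by blast
  \<comment> \<open>The exact coefficient of \<open>R\<^sup>2\<close>, after substituting
    \<open>Y = m / 2 * R\<^sup>2\<close> and \<open>lam = c * m\<close>.\<close>
  define g where "g = lam * m / 2 * (dH - dA + c * E)"
  have g: "g > 0" unfolding g_def using lam m0 pos by simp
  define B where "B = (\<Sum>S\<in>subsp k. \<bar>?w S\<bar>)"
  define N where "N = real (card (Wsp k))"
  have B0: "B \<ge> 0" by (simp add: B_def sum_nonneg)
  have N0: "N > 0" by (simp add: N_def card_Wsp)
  \<comment> \<open>The three summands bound, per \<open>R ^ 3\<close>, the terms in
    \<open>Y\<^sup>2\<close>, the mixed terms between the two halves, and the Taylor
    remainder.\<close>
  define C where "C = lam\<^sup>2 / 2 * (\<bar>E\<bar> + \<bar>dA - E\<bar>) * (m\<^sup>2 / 4) + lam\<^sup>2 / 2 * B * N * m + B * lam ^ 3 * N ^ 3"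
  have C0: "C \<ge> 0" unfolding C_def using lam m0 B0 N0 by simp
  \<comment> \<open>The bounds reduce \<open>R ^ 4\<close> to \<open>R ^ 3\<close>, keep the
    exponents within 1 for the Taylor estimate, and force \<open>C * R \<le> g\<close>;
    \<open>C + 1\<close> avoids a zero denominator.\<close>
  define r where "r = min 1 (min (1 / (lam * N)) (g / (C + 1)))"
  have r0: "r > 0" unfolding r_def using lam N0 g C0 by simp
  have "(\<Sum>S\<in>subsp k. ?w S) \<le> (\<Sum>S\<in>subsp k. ?w S * exp (lam * (\<Sum>v\<in>S. z v)))"
    if z0: "z vzero = 0" and zH: "\<forall>v\<in>?H. z v \<ge> 0" and zs: "(\<Sum>v\<in>Wsp k. z v) = 0"
      and zq: "(\<Sum>v\<in>?H. z v) = m / 2 * (\<Sum>v\<in>Wsp k. (z v)\<^sup>2)"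
      and zr: "sqrt (\<Sum>v\<in>Wsp k. (z v)\<^sup>2) < r" for z
  proof -
    define R where "R = sqrt (\<Sum>v\<in>Wsp k. (z v)\<^sup>2)"
    define Y where "Y = (\<Sum>v\<in>?H. z v)"
    have R0: "R \<ge> 0" by (simp add: R_def sum_nonneg)
    have R2: "R\<^sup>2 = (\<Sum>v\<in>Wsp k. (z v)\<^sup>2)" by (simp add: R_def sum_nonneg)
    have Y: "Y = m / 2 * R\<^sup>2" using zq by (simp add: Y_def R2)
    have Y0: "Y \<ge> 0" using zH by (simp add: Y_def sum_nonneg)
    have R1: "R \<le> 1" "R \<le> 1 / (lam * N)" "R \<le> g / (C + 1)"
      using zr by (auto simp: R_def r_def)
    have zR: "\<bar>z v\<bar> \<le> R" if "v \<in> Wsp k" for v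
      unfolding R_def using that by (intro abs_le_sqrt_sum_squares) auto
    have bound: "\<bar>\<Sum>v\<in>T. z v\<bar> \<le> N * R" if T: "T \<subseteq> Wsp k" for T
    proof -
      have "\<bar>\<Sum>v\<in>T. z v\<bar> \<le> (\<Sum>v\<in>T. \<bar>z v\<bar>)" by (rule sum_abs)
      also have "\<dots> \<le> (\<Sum>v\<in>Wsp k. \<bar>z v\<bar>)" using T by (intro sum_mono2) auto
      also have "\<dots> \<le> (\<Sum>v\<in>Wsp k. R)" by (intro sum_mono zR)
      finally show ?thesis by (simp add: N_def)
    qed
    define X where "X S = (\<Sum>v\<in>S \<inter> ?A. z v)" for S
    define V where "V S = (\<Sum>v\<in>S \<inter> ?H. z v)" for S
    define Z where "Z S = (\<Sum>v\<in>S. z v)" for S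
    have split: "(\<Sum>v\<in>S. f v) = (\<Sum>v\<in>S \<inter> ?A. f v) + (\<Sum>v\<in>S \<inter> ?H. f v)"
      if "S \<subseteq> Wsp k" for S and f :: "(nat \<Rightarrow> bool) \<Rightarrow> real"
    proof -
      have "S = (S \<inter> ?A) \<union> (S \<inter> ?H)" "(S \<inter> ?A) \<inter> (S \<inter> ?H) = {}"
        using that Wsp_split[of k] by auto
      then show ?thesis by (metis sum.union_disjoint finite_Int finite_off0 finite_hyp0)
    qed
    have splitW: "(\<Sum>v\<in>Wsp k. f v) = (\<Sum>v\<in>?A. f v) + (\<Sum>v\<in>?H. f v)" for f :: "(nat \<Rightarrow> bool) \<Rightarrow> real"
    proof -
      have "Wsp k \<inter> ?A = ?A" "Wsp k \<inter> ?H = ?H" using Wsp_split[of k] by auto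
      then show ?thesis using split[of "Wsp k" f] by simp
    qed
    have Zs: "Z S = X S + V S" if "S \<in> subsp k" for S
      unfolding X_def V_def Z_def by (rule split) (rule subspD(1)[OF that])
    have Ab: "(\<Sum>v\<in>?A. z v) = - Y" using zs splitW[of z] by (simp add: Y_def)
    have lin: "(\<Sum>S\<in>subsp k. ?w S * Z S) = (dH - dA) * Y"
    proof -
      have "(\<Sum>S\<in>subsp k. ?w S * Z S) = (\<Sum>S\<in>subsp k. ?w S * X S) + (\<Sum>S\<in>subsp k. ?w S * V S)"
        by (simp add: Zs distrib_left sum.distrib)
      moreover have "(\<Sum>S\<in>subsp k. ?w S * X S) = dA * (\<Sum>v\<in>?A. z v)"
        unfolding X_def by (rule sum_ew_linear) (use dA Wsp_split[of k] in auto)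
      moreover have "(\<Sum>S\<in>subsp k. ?w S * V S) = dH * Y"
        unfolding V_def Y_def by (rule sum_ew_linear) (use dH z0 Wsp_split[of k] in auto)
      ultimately show ?thesis by (simp add: Ab algebra_simps)
    qed
    \<comment> \<open>The squares on the hyperplane sum to at most \<open>Y\<^sup>2\<close> because
      \<open>z\<close> is nonnegative there, so they are of fourth order in
      \<open>R\<close>.\<close>
    have quad: "(\<Sum>S\<in>subsp k. ?w S * (X S)\<^sup>2) \<ge> E * R\<^sup>2 - (\<bar>E\<bar> + \<bar>dA - E\<bar>) * Y\<^sup>2"
    proof -
      let ?h = "\<Sum>v\<in>?H. (z v)\<^sup>2"
      have h: "0 \<le> ?h" "?h \<le> Y\<^sup>2"
        unfolding Y_def using zH by (auto intro!: sum_nonneg sum_power2_le_power2_sum)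
      have "(\<Sum>S\<in>subsp k. ?w S * (X S)\<^sup>2) = E * (\<Sum>v\<in>?A. (z v)\<^sup>2) + (dA - E) * (\<Sum>v\<in>?A. z v)\<^sup>2"
        unfolding X_def by (rule sum_ew_quadratic) (use dA dE in auto)
      also have "\<dots> = E * R\<^sup>2 - E * ?h + (dA - E) * Y\<^sup>2"
        using splitW[of "\<lambda>v. (z v)\<^sup>2"] by (simp add: R2 Ab algebra_simps)
      also have "\<dots> \<ge> E * R\<^sup>2 - (\<bar>E\<bar> + \<bar>dA - E\<bar>) * Y\<^sup>2"
      proof -
        have "E * ?h \<le> \<bar>E\<bar> * ?h" by (rule mult_right_mono) (use h in auto)
        also have "\<dots> \<le> \<bar>E\<bar> * Y\<^sup>2" using h by (intro mult_left_mono) auto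
        finally have "E * ?h \<le> \<bar>E\<bar> * Y\<^sup>2" .
        moreover have "- \<bar>dA - E\<bar> * Y\<^sup>2 \<le> (dA - E) * Y\<^sup>2" by (intro mult_right_mono) auto
        ultimately show ?thesis by (simp add: distrib_right)
      qed
      finally show ?thesis .
    qed
    have weighted: "\<bar>\<Sum>S\<in>subsp k. ?w S * f S\<bar> \<le> B * b"
      if "\<And>S. S \<in> subsp k \<Longrightarrow> \<bar>f S\<bar> \<le> b" for f b
    proof -
      have "\<bar>\<Sum>S\<in>subsp k. ?w S * f S\<bar> \<le> (\<Sum>S\<in>subsp k. \<bar>?w S * f S\<bar>)" by (rule sum_abs)
      also have "\<dots> \<le> (\<Sum>S\<in>subsp k. \<bar>?w S\<bar> * b)"
        by (intro sum_mono) (auto simp: abs_mult intro!: mult_left_mono that)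
      finally show ?thesis by (simp add: B_def sum_distrib_right)
    qed
    \<comment> \<open>The difference factors as \<open>V S * (Z S + X S)\<close>, where
      \<open>V S \<le> Y\<close> is already of second order.\<close>
    have cross: "\<bar>\<Sum>S\<in>subsp k. ?w S * ((Z S)\<^sup>2 - (X S)\<^sup>2)\<bar> \<le> B * (Y * (2 * N * R))"
    proof (rule weighted)
      fix S assume S: "S \<in> subsp k"
      have SW: "S \<subseteq> Wsp k" by (rule subspD(1)[OF S])
      have "0 \<le> V S" "V S \<le> Y" unfolding V_def Y_def
        using zH by (auto intro!: sum_nonneg sum_mono2)
      moreover have "\<bar>Z S + X S\<bar> \<le> 2 * N * R"
        using bound[OF SW] bound[of "S \<inter> ?A"] SW unfolding Z_def X_def by fastforce
      ultimately have "\<bar>V S * (Z S + X S)\<bar> \<le> Y * (2 * N * R)"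
        unfolding abs_mult using Y0 by (intro mult_mono) auto
      moreover have "(Z S)\<^sup>2 - (X S)\<^sup>2 = V S * (Z S + X S)"
        using Zs[OF S] by (simp add: power2_eq_square algebra_simps)
      ultimately show "\<bar>(Z S)\<^sup>2 - (X S)\<^sup>2\<bar> \<le> Y * (2 * N * R)" by simp
    qed
    have taylor: "\<bar>\<Sum>S\<in>subsp k. ?w S * (exp (lam * Z S) - 1 - lam * Z S - (lam * Z S)\<^sup>2 / 2)\<bar>
        \<le> B * (lam * (N * R)) ^ 3"
    proof (rule weighted)
      fix S assume S: "S \<in> subsp k"
      have a: "\<bar>lam * Z S\<bar> \<le> lam * (N * R)"
        using bound[OF subspD(1)[OF S]] lam by (auto simp: Z_def abs_mult intro!: mult_left_mono)
      also have "\<dots> \<le> 1" using R1(2) lam N0 by (simp add: field_simps)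
      finally have "\<bar>exp (lam * Z S) - 1 - lam * Z S - (lam * Z S)\<^sup>2 / 2\<bar> \<le> \<bar>lam * Z S\<bar> ^ 3"
        by (rule exp_taylor_cubic)
      also have "\<dots> \<le> (lam * (N * R)) ^ 3" using a by (intro power_mono) auto
      finally show "\<bar>exp (lam * Z S) - 1 - lam * Z S - (lam * Z S)\<^sup>2 / 2\<bar> \<le> (lam * (N * R)) ^ 3" .
    qed
    have expand: "(\<Sum>S\<in>subsp k. ?w S * exp (lam * Z S)) - (\<Sum>S\<in>subsp k. ?w S)
      = (\<Sum>S\<in>subsp k. ?w S * (exp (lam * Z S) - 1 - lam * Z S - (lam * Z S)\<^sup>2 / 2))
        + lam * (\<Sum>S\<in>subsp k. ?w S * Z S)
        + lam\<^sup>2 / 2 * ((\<Sum>S\<in>subsp k. ?w S * ((Z S)\<^sup>2 - (X S)\<^sup>2)) + (\<Sum>S\<in>subsp k. ?w S * (X S)\<^sup>2))"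
      unfolding sum_distrib_left sum.distrib[symmetric] sum_subtractf[symmetric]
      by (intro sum.cong refl) (simp add: field_simps power2_eq_square)
    have quart: "Y\<^sup>2 \<le> m\<^sup>2 / 4 * R ^ 3"
    proof -
      have "Y\<^sup>2 = m\<^sup>2 / 4 * (R * R ^ 3)" by (simp add: Y power2_eq_square eval_nat_numeral)
      also have "\<dots> \<le> m\<^sup>2 / 4 * (1 * R ^ 3)"
        using R1(1) R0 by (intro mult_left_mono mult_right_mono) auto
      finally show ?thesis by simp
    qed
    let ?p = "\<bar>E\<bar> + \<bar>dA - E\<bar>"
    have "(\<Sum>S\<in>subsp k. ?w S * exp (lam * Z S)) - (\<Sum>S\<in>subsp k. ?w S)
      \<ge> - (B * (lam * (N * R)) ^ 3) + lam * ((dH - dA) * Y)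
        + lam\<^sup>2 / 2 * (- (B * (Y * (2 * N * R))) + (E * R\<^sup>2 - ?p * Y\<^sup>2))"
      unfolding expand lin using taylor cross quad
      by (intro add_mono mult_left_mono order.refl) (auto simp: abs_le_iff)
    moreover have "?p * Y\<^sup>2 \<le> ?p * (m\<^sup>2 / 4 * R ^ 3)"
      by (intro mult_left_mono quart) auto
    then have "lam\<^sup>2 / 2 * (- (B * (Y * (2 * N * R))) + (E * R\<^sup>2 - ?p * (m\<^sup>2 / 4 * R ^ 3)))
        \<le> lam\<^sup>2 / 2 * (- (B * (Y * (2 * N * R))) + (E * R\<^sup>2 - ?p * Y\<^sup>2))"
      by (intro mult_left_mono) auto
    moreover have "- (B * (lam * (N * R)) ^ 3) + lam * ((dH - dA) * Y)
        + lam\<^sup>2 / 2 * (- (B * (Y * (2 * N * R))) + (E * R\<^sup>2 - ?p * (m\<^sup>2 / 4 * R ^ 3)))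
        = R\<^sup>2 * (g - C * R)"
      unfolding g_def C_def Y cm[symmetric]
      by (simp add: field_simps power2_eq_square power3_eq_cube)
    moreover have "R\<^sup>2 * (g - C * R) \<ge> 0"
    proof -
      have "C * R \<le> (C + 1) * R" using R0 by (simp add: distrib_right)
      also have "\<dots> \<le> g" using R1(3) C0 by (simp add: field_simps)
      finally show ?thesis by simp
    qed
    ultimately show ?thesis unfolding Z_def by linarith
  qed
  then show ?thesis using r0 unfolding c_def by blast
qed

section \<open>The local minimum\<close>

lemma qcheck_eq:
  assumes "k \<ge> 1"
  shows "qcheck k i = (if 2^(k-1) \<le> i \<and> i < 2^k then 1 / 2^(k-1) else 0)"
proof -
  have "2 powr (1 - real k) = 2 powr (- real (k - 1))" using assms by (simp add: of_nat_diff)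
  also have "\<dots> = 1 / 2^(k-1)" by (simp add: powr_minus_divide powr_realpow)
  finally show ?thesis by (simp add: qcheck_def)
qed

text \<open>For coordinates summing to 1 with \<open>q 0 = 0\<close>, the squared distance to the
  uniform vector is the squared norm minus \<open>1 / (2^k - 1)\<close>, so the radius condition
  only fixes the norm.\<close>

lemma Crho_iff:
  assumes k: "k \<ge> 1"
  shows "q \<in> Crho k \<longleftrightarrow> q 0 = 0 \<and> (\<forall>i<2^k. q i \<ge> 0) \<and> (\<Sum>i<2^k. q i) = 1 \<and>
    (\<Sum>i<2^k. (q i)\<^sup>2) = 1 / 2^(k-1)"
proof -
  define m where "m = (2::real)^(k-1)"
  have m: "m \<ge> 1" by (simp add: m_def)
  have N: "(2::real)^k = 2 * m" using k by (metis m_def power_Suc Suc_diff_1 Suc_le_eq One_nat_def)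
  have "(\<Sum>i=1..<2^k. (q i - 1 / (2^k - 1))^2) = (\<Sum>i<2^k. (q i)\<^sup>2) - 1 / (2 * m - 1)"
    if q0: "q 0 = 0" and qs: "(\<Sum>i<2^k. q i) = 1"
  proof -
    let ?u = "1 / (2 * m - 1)"
    have drop0: "(\<Sum>i<2^k. f i) = f 0 + (\<Sum>i=1..<2^k. f i)" for f :: "nat \<Rightarrow> real"
      unfolding lessThan_atLeast0 by (subst sum.atLeast_Suc_lessThan) auto
    have s1: "(\<Sum>i=1..<2^k. q i) = 1" and s2: "(\<Sum>i=1..<2^k. (q i)\<^sup>2) = (\<Sum>i<2^k. (q i)\<^sup>2)"
      using drop0[of q] drop0[of "\<lambda>i. (q i)\<^sup>2"] q0 qs by auto
    have "(\<Sum>i=1..<2^k. (q i - ?u)^2)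
        = (\<Sum>i=1..<2^k. (q i)\<^sup>2) - 2 * ?u * (\<Sum>i=1..<2^k. q i) + (\<Sum>i\<in>{1..<2^k::nat}. ?u\<^sup>2)"
      unfolding sum_distrib_left sum_subtractf[symmetric] sum.distrib[symmetric]
      by (intro sum.cong refl) (simp add: power2_diff)
    also have "(\<Sum>i\<in>{1..<2^k::nat}. ?u\<^sup>2) = (2 * m - 1) * ?u\<^sup>2"
      using N by (simp add: of_nat_diff)
    also have "\<dots> = ?u" using m by (simp add: power2_eq_square)
    finally show ?thesis unfolding N s1 s2 by simp
  qed
  \<comment> \<open>Partial fractions, with \<open>2^k = 2 * m\<close>.\<close>
  moreover have "(2^(k-1) - 1) / ((2^k - 2^(k-1)) * (2^k - 1)) = 1 / m - 1 / (2 * m - 1)"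
    using m unfolding N m_def[symmetric] by (simp add: field_simps)
  ultimately show ?thesis
    unfolding Crho_def mem_Collect_eq real_sqrt_eq_iff m_def[symmetric] by auto
qed

lemma sum_qcheck:
  assumes k: "k \<ge> 1"
  shows "(\<Sum>i<2^k. qcheck k i) = 1" "(\<Sum>i<2^k. (qcheck k i)\<^sup>2) = 1 / 2^(k-1)"
proof -
  have N: "(2::nat)^k = 2 * 2^(k-1)" using k by (metis power_Suc Suc_diff_1 Suc_le_eq One_nat_def)
  have s: "(\<Sum>i<2^k::nat. if 2^(k-1) \<le> i \<and> i < 2^k then x else 0) = 2^(k-1) * x" for x :: real
  proof -
    have "(\<Sum>i<2^k::nat. if 2^(k-1) \<le> i \<and> i < 2^k then x else 0) = (\<Sum>i=2^(k-1)..<2^k::nat. x)"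
      by (rule sum.mono_neutral_cong_right) auto
    then show ?thesis by (simp add: N)
  qed
  show "(\<Sum>i<2^k. qcheck k i) = 1" unfolding qcheck_eq[OF k] s by simp
  have "(\<Sum>i<2^k. (qcheck k i)\<^sup>2) = (\<Sum>i<2^k::nat. if 2^(k-1) \<le> i \<and> i < 2^k then (1 / 2^(k-1))\<^sup>2 else 0)"
    by (intro sum.cong refl) (simp add: qcheck_eq[OF k])
  then show "(\<Sum>i<2^k. (qcheck k i)\<^sup>2) = 1 / 2^(k-1)"
    unfolding s by (simp add: power2_eq_square)
qed

lemma qcheck_Crho: "k \<ge> 1 \<Longrightarrow> qcheck k \<in> Crho k"
  using sum_qcheck[of k] by (simp add: Crho_iff) (simp add: qcheck_eq)

lemma nu_mem:
  assumes "k \<ge> 1" "i < 2^k"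
  shows "nu k i \<in> off0 k \<longleftrightarrow> 2^(k-1) \<le> i" "nu k i \<in> hyp0 k \<longleftrightarrow> i < 2^(k-1)"
proof -
  have N: "(2::nat)^k = 2 * 2^(k-1)" using assms(1) by (metis power_Suc Suc_diff_1 Suc_le_eq One_nat_def)
  have W: "nu k i \<in> Wsp k" by (simp add: nu_def Wsp_def)
  have b: "bit i (k - 1) \<longleftrightarrow> 2^(k-1) \<le> i"
  proof (cases "2^(k-1) \<le> i")
    case True
    then have "i div 2^(k-1) = 1" using assms(2) N by (intro div_nat_eqI) auto
    then show ?thesis using True by (simp add: bit_iff_odd)
  qed (simp add: bit_iff_odd)
  show "nu k i \<in> off0 k \<longleftrightarrow> 2^(k-1) \<le> i" "nu k i \<in> hyp0 k \<longleftrightarrow> i < 2^(k-1)"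
    using W b assms(1) by (auto simp: off0_def hyp0_def nu_def)
qed

lemma sum_nu:
  assumes "T \<subseteq> Wsp k"
  shows "(\<Sum>i | i < 2^k \<and> nu k i \<in> T. f (nu k i)) = (\<Sum>v\<in>T. f v)"
proof (rule sum.reindex_bij_betw)
  show "bij_betw (nu k) {i. i < 2^k \<and> nu k i \<in> T} T"
    by (rule bij_betw_subset[OF nu_bij]) (use nu_bij[of k] assms in \<open>auto simp: bij_betw_def\<close>)
qed

lemma sum_nu_Wsp: "(\<Sum>i<2^k. f (nu k i)) = (\<Sum>v\<in>Wsp k. f v)"
  by (rule sum.reindex_bij_betw[OF nu_bij])

text \<open>Including the whole space adds the term 1, as its \<open>zeta\<close> is the total mass;
  this explains the \<open>- 1\<close>. The factor in front of the sum is \<open>eps\<close> to the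
  power \<open>n\<close>.\<close>

lemma loss_eq:
  assumes eps: "eps > 0" and q: "(\<Sum>i<2^k. q i) = 1"
  shows "loss k n eps q = real n * (1 - eps) - real k - 1
    + exp (real n * ln eps) * (\<Sum>S\<in>subsp k. wt k S * exp (- real n * ln eps * zeta k S q))"
proof -
  let ?g = "\<lambda>S. eps powr (real n * (1 - zeta k S q))"
  have "zeta k (Wsp k) q = 1"
  proof -
    have "{i. i < 2^k \<and> nu k i \<in> Wsp k} = {..<2^k}" by (auto simp: nu_def Wsp_def)
    then show ?thesis using q by (simp add: zeta_def)
  qed
  moreover have "cod k (Wsp k) = 0" using cod_eq_0_iff[OF Wsp_subsp] by blast
  ultimately have W: "wt k (Wsp k) * ?g (Wsp k) = 1" using eps by (simp add: wt_def Kc_def)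
  have "(\<Sum>S\<in>subsp k. wt k S * ?g S) = wt k (Wsp k) * ?g (Wsp k) + (\<Sum>S\<in>subsp k - {Wsp k}. wt k S * ?g S)"
    by (rule sum.remove) (auto simp: Wsp_subsp)
  then have "loss k n eps q = real n * (1 - eps) - real k - 1 + (\<Sum>S\<in>subsp k. wt k S * ?g S)"
    unfolding loss_def sum_Xi_eq W by simp
  moreover have "wt k S * ?g S
      = exp (real n * ln eps) * (wt k S * exp (- real n * ln eps * zeta k S q))" for S
    using eps by (simp add: powr_def exp_add[symmetric] algebra_simps)
  ultimately show ?thesis by (simp only: sum_distrib_left)
qed

theorem theorem4:
  fixes k n :: nat and eps :: real
  assumes "k \<ge> 2" and "n \<ge> 1" and "0 < eps" and "eps < 1"
  shows "qcheck k \<in> Crho k \<and> local_min_on k (loss k n eps) (Crho k) (qcheck k)"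
proof -
  have k1: "k \<ge> 1" using assms(1) by simp
  let ?p = "qcheck k" and ?H = "hyp0 k" and ?A = "off0 k"
  define m where "m = (2::real)^(k-1)"
  have m0: "m > 0" by (simp add: m_def)
  define lam where "lam = - real n * ln eps"
  have lam: "lam > 0" using assms by (simp add: lam_def mult_neg_pos mult_pos_neg)
  have pC: "?p \<in> Crho k" using k1 by (rule qcheck_Crho)
  obtain r where r: "r > 0" and min: "\<And>z. z vzero = 0 \<Longrightarrow> (\<forall>v\<in>?H. z v \<ge> 0) \<Longrightarrow>
      (\<Sum>v\<in>Wsp k. z v) = 0 \<Longrightarrow> (\<Sum>v\<in>?H. z v) = m / 2 * (\<Sum>v\<in>Wsp k. (z v)\<^sup>2) \<Longrightarrow>
      sqrt (\<Sum>v\<in>Wsp k. (z v)\<^sup>2) < r \<Longrightarrow>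
      (\<Sum>S\<in>subsp k. ew k (lam / m) S)
        \<le> (\<Sum>S\<in>subsp k. ew k (lam / m) S * exp (lam * (\<Sum>v\<in>S. z v)))"
    using second_order_min[OF assms(1) lam] unfolding m_def by blast
  have zeta_p: "zeta k S ?p = real (card (S \<inter> ?A)) / m" if "S \<in> subsp k" for S
  proof -
    have "zeta k S ?p = (\<Sum>i | i < 2^k \<and> nu k i \<in> S. of_bool (nu k i \<in> ?A) / m)"
      unfolding zeta_def by (intro sum.cong refl) (auto simp: qcheck_eq[OF k1] nu_mem(1)[OF k1] m_def)
    also have "\<dots> = (\<Sum>v\<in>S. of_bool (v \<in> ?A) / m)"
      by (rule sum_nu) (rule subspD(1)[OF that])
    also have "\<dots> = real (card (S \<inter> ?A)) / m"
      using subsp_finite[OF that] by (simp add: sum_divide_distrib[symmetric])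
    finally show ?thesis .
  qed
  have "loss k n eps ?p \<le> loss k n eps q" if q: "q \<in> Crho k" and d: "vdist k ?p q < r" for q
  proof -
    \<comment> \<open>The displacement, carried from indices to vectors by inverting
      \<open>nu\<close>.\<close>
    define z where "z v = q (inv_into {..<2^k} (nu k) v) - ?p (inv_into {..<2^k} (nu k) v)" for v
    have z_nu: "z (nu k i) = q i - ?p i" if "i < 2^k" for i
      using that nu_bij[of k] by (simp add: z_def bij_betw_def)
    note qD = q[unfolded Crho_iff[OF k1]] and pD = pC[unfolded Crho_iff[OF k1]]
    have z0: "z vzero = 0"
    proof -
      have "nu k 0 = vzero" by (simp add: nu_def)
      then show ?thesis using z_nu[of 0] qD pD by simp
    qed
    have zH: "\<forall>v\<in>?H. z v \<ge> 0"
    proof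
      fix v assume v: "v \<in> ?H"
      then obtain i where i: "i < 2^k" "v = nu k i"
        using nu_bij[of k] by (auto simp: bij_betw_def hyp0_def)
      then have "?p i = 0" using v nu_mem(2)[OF k1 i(1)] by (simp add: qcheck_eq[OF k1])
      then show "z v \<ge> 0" using i z_nu[OF i(1)] qD by simp
    qed
    have zs: "(\<Sum>v\<in>Wsp k. z v) = 0"
      using qD pD by (simp add: sum_nu_Wsp[symmetric] z_nu sum_subtractf)
    \<comment> \<open>With \<open>p = qcheck k\<close>, expand \<open>(q - p)^2\<close> as
      \<open>q^2 - p^2 - 2 p (q - p)\<close>, where \<open>p\<close> is \<open>1 / m\<close> on
      \<open>off0 k\<close> and 0 elsewhere. Both squared norms equal \<open>1 / m\<close>, so only
      the linear term remains.\<close>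
    have "(\<Sum>v\<in>Wsp k. (z v)\<^sup>2) = (\<Sum>i<2^k. (q i)\<^sup>2 - (?p i)\<^sup>2 - 2 / m * (of_bool (nu k i \<in> ?A) * z (nu k i)))"
      unfolding sum_nu_Wsp[symmetric]
      by (intro sum.cong refl)
        (auto simp: z_nu qcheck_eq[OF k1] nu_mem(1)[OF k1] m_def power2_eq_square algebra_simps)
    also have "\<dots> = - (2 / m * (\<Sum>v\<in>Wsp k. of_bool (v \<in> ?A) * z v))"
      unfolding sum_nu_Wsp[symmetric] sum_subtractf sum_distrib_left[symmetric] using qD pD by simp
    also have "(\<Sum>v\<in>Wsp k. of_bool (v \<in> ?A) * z v) = (\<Sum>v\<in>?A. z v)"
      by (rule sum.mono_neutral_cong_right) (auto simp: off0_def)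
    also have "(\<Sum>v\<in>?A. z v) = - (\<Sum>v\<in>?H. z v)"
      using zs sum.union_disjoint[OF finite_hyp0 finite_off0 Wsp_split(2)[of k], of z]
      by (simp add: Wsp_split(1)[symmetric])
    finally have zq: "(\<Sum>v\<in>?H. z v) = m / 2 * (\<Sum>v\<in>Wsp k. (z v)\<^sup>2)" using m0 by simp
    have "vdist k ?p q = sqrt (\<Sum>v\<in>Wsp k. (z v)\<^sup>2)"
      unfolding vdist_def sum_nu_Wsp[symmetric]
      by (simp add: z_nu power2_commute)
    with d have zr: "sqrt (\<Sum>v\<in>Wsp k. (z v)\<^sup>2) < r" by simp
    have zeta_q: "zeta k S q = zeta k S ?p + (\<Sum>v\<in>S. z v)" if "S \<in> subsp k" for S
    proof -
      have "(\<Sum>v\<in>S. z v) = (\<Sum>i | i < 2^k \<and> nu k i \<in> S. q i - ?p i)"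
        unfolding sum_nu[OF subspD(1)[OF that], symmetric] by (intro sum.cong refl) (simp add: z_nu)
      then show ?thesis by (simp add: zeta_def sum_subtractf)
    qed
    have p_sum: "(\<Sum>S\<in>subsp k. wt k S * exp (lam * zeta k S ?p)) = (\<Sum>S\<in>subsp k. ew k (lam / m) S)"
      by (intro sum.cong refl) (simp add: zeta_p ew_def)
    have q_sum: "(\<Sum>S\<in>subsp k. wt k S * exp (lam * zeta k S q))
        = (\<Sum>S\<in>subsp k. ew k (lam / m) S * exp (lam * (\<Sum>v\<in>S. z v)))"
      by (intro sum.cong refl) (simp add: zeta_q zeta_p ew_def distrib_left exp_add)
    have "(\<Sum>S\<in>subsp k. wt k S * exp (lam * zeta k S ?p)) \<le> (\<Sum>S\<in>subsp k. wt k S * exp (lam * zeta k S q))"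
      unfolding p_sum q_sum by (rule min[OF z0 zH zs zq zr])
    then show ?thesis
      using qD pD assms(3) unfolding lam_def by (simp add: loss_eq)
  qed
  then show ?thesis unfolding local_min_on_def using pC r by blast
qed

end
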